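(* Let $n\ge 1$ and let $f=f(x)$ be a continuous real-valued function on $I=[-1;1]$. Let $\rho_n(x)=\sum_{k=1}^n\frac{1}{x-z_k}$ be a real-valued logarithmic derivative of degree $n$ all of whose poles $z_k$ are pairwise distinct and satisfy $|z_k|>1$, $k=1,\dots,n$. Then $\rho_n$ is the unique logarithmic derivative of best uniform approximation of $f$ on $I$ if and only if there exist $n+1$ points in $I$ forming a Chebyshev alternance of the difference $f-\rho_n$ on $I$.
   Context: A logarithmic derivative (l.d.) of degree $m\ge 1$ is a rational function $\rho(z)=P'(z)/P(z)=\sum_{k=1}^m \frac{1}{z-z_k}$, where $P(z)=\prod_{k=1}^m (z-z_k)$, $z_k\in\mathbb{C}$ (repetitions allowed); the l.d. of degree $0$ is $\rho\equiv 0$. Only real-valued l.d.s are considered, i.e. the multiset $\{z_k\}$ is symmetric with respect to the real line. Let $I:=[-1;1]$ and $\|g\|:=\max_{x\in I}|g(x)|$, understood as $+\infty$ if $g$ has a pole on $I$. An l.d. $\widetilde\rho_n$ is an l.d. of best uniform approximation of $f$ on $I$ if $\|f-\widetilde\rho_n\|=\inf_{\rho}\|f-\rho\|$, the infimum being over all real-valued l.d.s of degree less than or equal to $n$. Points $t_1<t_2<\dots<t_{N}$ in $I$ form a (Chebyshev) alternance of $f-\rho_n$ on $I$ if $f(t_k)-\rho_n(t_k)=\pm(-1)^k\|f-\rho_n\|$, $k=1,\dots,N$, with the sign $\pm$ the same for all $k$. *)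

theory Defs
  imports "HOL-Analysis.Analysis" "HOL-Library.Multiset"
begin

text \<open>A logarithmic derivative is represented by the multiset of its poles, i.e. of the zeros of the
  monic polynomial P in P'/P; its degree is the size of the multiset.
  Lemma \<open>log_deriv_inject\<close> below shows that the function determines the multiset.\<close>

definition log_deriv :: "complex multiset \<Rightarrow> complex \<Rightarrow> complex" where
  "log_deriv Z w = (\<Sum>a\<in>#Z. 1 / (w - a))"

definition real_poles :: "complex multiset \<Rightarrow> bool" where
  "real_poles Z \<longleftrightarrow> image_mset cnj Z = Z"

text \<open>For \<open>real_poles Z\<close> taking the real part loses nothing, see \<open>of_real_log_deriv_real\<close>.\<close>

definition log_deriv_real :: "complex multiset \<Rightarrow> real \<Rightarrow> real" where
  "log_deriv_real Z x = Re (log_deriv Z (of_real x))"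

text \<open>The first case is needed because division by zero yields zero. All residues of a logarithmic
  derivative are positive, so no poles cancel, and for \<open>f\<close> continuous on \<open>[-1,1]\<close> the poles of
  the difference there are exactly the elements of \<open>Z\<close> lying in that interval.\<close>

definition deviation :: "(real \<Rightarrow> real) \<Rightarrow> complex multiset \<Rightarrow> ereal" where
  "deviation f Z =
     (if \<exists>x\<in>{-1..1::real}. of_real x \<in># Z then \<infinity>
      else (SUP x\<in>{-1..1}. ereal \<bar>f x - log_deriv_real Z x\<bar>))"

definition admissible :: "nat \<Rightarrow> complex multiset set" where
  "admissible n = {Z. real_poles Z \<and> size Z \<le> n}"

definition best_approx :: "nat \<Rightarrow> (real \<Rightarrow> real) \<Rightarrow> complex multiset \<Rightarrow> bool" where
  "best_approx n f Z \<longleftrightarrow>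
     Z \<in> admissible n \<and> deviation f Z = (INF W\<in>admissible n. deviation f W)"

definition alternance :: "(real \<Rightarrow> real) \<Rightarrow> complex multiset \<Rightarrow> nat \<Rightarrow> (nat \<Rightarrow> real) \<Rightarrow> bool" where
  "alternance f Z N t \<longleftrightarrow>
     strict_mono_on {1..N} t \<and> t ` {1..N} \<subseteq> {-1..1} \<and>
     (\<exists>s\<in>{1, -1 :: real}. \<forall>k\<in>{1..N}.
        ereal (f (t k) - log_deriv_real Z (t k)) = ereal (s * (-1) ^ k) * deviation f Z)"

lemma of_real_log_deriv_real:
  assumes "real_poles Z"
  shows "of_real (log_deriv_real Z x) = log_deriv Z (of_real x)"
proof -
  have c: "cnj (\<Sum>a\<in>#Y. 1 / (of_real x - a)) = (\<Sum>a\<in>#image_mset cnj Y. 1 / (of_real x - a))" for Y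
    by (induction Y) auto
  have "cnj (log_deriv Z (of_real x)) = log_deriv Z (of_real x)"
    using c[of Z] assms unfolding log_deriv_def real_poles_def by simp
  then show ?thesis
    unfolding log_deriv_real_def by (simp add: complex_eq_iff)
qed

lemma log_deriv_residue: "((\<lambda>w. (w - b) * log_deriv Z w) \<longlongrightarrow> of_nat (count Z b)) (at b)"
proof (induction Z)
  case empty
  then show ?case by (simp add: log_deriv_def)
next
  case (add a Z)
  have "((\<lambda>w. (w - b) * (1 / (w - a))) \<longlongrightarrow> (if a = b then 1 else 0)) (at b)"
  proof (cases "a = b")
    case True
    have "((\<lambda>w. 1) \<longlongrightarrow> (1::complex)) (at b)" by simp
    then have "((\<lambda>w. (w - b) * (1 / (w - b))) \<longlongrightarrow> 1) (at b)"
      by (rule Lim_transform_eventually) (auto simp: eventually_at_filter)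
    then show ?thesis using True by simp
  next
    case False
    have "((\<lambda>w. (w - b) * (1 / (w - a))) \<longlongrightarrow> (b - b) * (1 / (b - a))) (at b)"
      using False by (intro tendsto_intros) auto
    then show ?thesis using False by simp
  qed
  from tendsto_add[OF this add.IH] show ?case
    by (auto simp: log_deriv_def ring_distribs)
qed

lemma log_deriv_inject: "log_deriv Z = log_deriv W \<longleftrightarrow> Z = W"
proof
  assume eq: "log_deriv Z = log_deriv W"
  show "Z = W"
  proof (rule multiset_eqI)
    fix b
    have "(of_nat (count Z b) :: complex) = of_nat (count W b)"
      using log_deriv_residue[of b Z] log_deriv_residue[of b W] unfolding eq
      by (rule tendsto_unique[OF at_neq_bot])
    then show "count Z b = count W b" by simp
  qed
qed simp

end

theory Submission
  imports Defs
begin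

text \<open>Write \<open>\<rho>\<close> for the given logarithmic derivative \<open>P'/P\<close>, and let \<open>Z\<close> be the set of its poles. Moving a simple
pole \<open>a\<close> changes \<open>\<rho>\<close> to first order by a multiple of \<open>1/(x - a)\<^sup>2\<close>. On the other hand, if \<open>Q'/Q\<close> is a competitor of
degree at most \<open>n\<close>, then \<open>Q'/Q - P'/P = (Q/P)' * P/Q\<close>,
and since \<open>Q/P\<close> is a constant plus \<open>\<Sum>\<^sub>a c\<^sub>a/(x - a)\<close>, the sign of the difference is governed by
\<open>\<Sum>\<^sub>a c\<^sub>a/(x - a)\<^sup>2\<close>. Both directions of the theorem therefore follow, as in the classical theory of
Chebyshev, once the \<open>n\<close> functions \<open>1/(x - a)\<^sup>2\<close> are known to form a Chebyshev system on \<open>[-1,1]\<close>. This is where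
the hypothesis \<open>\<bar>a\<bar> > 1\<close> enters.

The Chebyshev property rests on Borchardt's identity, by which the determinant of \<open>1/(x\<^sub>i - z\<^sub>j)\<^sup>2\<close> is
the determinant times the permanent of the Cauchy matrix \<open>1/(x\<^sub>i - z\<^sub>j)\<close>. The form used here avoids
determinants. Lemma \<open>double_pole_expansion\<close> says that, for nodes \<open>Y\<close> with one element fewer than \<open>Z\<close>, the
product of \<open>\<Prod>(x - y)/\<Prod>(x - a)\<close> with the Cauchy permanent of \<open>Y \<union> {x}\<close> and \<open>Z\<close> has only pure double poles, so that it
is an explicit combination of the functions \<open>1/(x - a)\<^sup>2\<close> that vanishes on \<open>Y\<close>. The permanent has constant sign for
real nodes in \<open>[-1,1]\<close> (\<open>cauchy_perm_constant_sign\<close>): expanded along a pair of conjugate columns, it becomes a sum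
with positive coefficients, because \<open>Re ((x - a) (y - cnj a)) > 0\<close> whenever \<open>\<bar>x\<bar>, \<bar>y\<bar> \<le> 1 < \<bar>a\<bar>\<close>.

For sufficiency, the expansion is applied with the roles of nodes and poles exchanged: \<open>n + 1\<close> alternance
points act as poles and \<open>Z\<close> as the set of nodes. This gives a linear relation with alternating signs between the
values of any combination of the \<open>1/(x - a)\<^sup>2\<close> at these points. If the competitor is at least as good as \<open>\<rho>\<close>, its
difference from \<open>\<rho>\<close> weakly alternates at the points, so all terms of the relation have the same sign and vanish;
then all \<open>c\<^sub>a\<close> vanish, which means that \<open>P\<close> divides \<open>Q\<close>, and \<open>Q = P\<close> by comparison of degrees.

For necessity, suppose there is no alternance of \<open>n + 1\<close> points. Then the extremal points of \<open>f - \<rho>\<close> of either sign are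
separated by at most \<open>n - 1\<close> points. The expansion provides a combination of the \<open>1/(x - a)\<^sup>2\<close> that
changes sign exactly there, and moving the poles a little along its coefficients lowers the deviation, so \<open>\<rho>\<close> is not
best.\<close>

section \<open>Permanents\<close>

text \<open>The rows and columns are indexed by sets instead of numbers, so that deleting a row or column is a set difference
and rows and columns enter symmetrically. If the index sets have different sizes, the value is 0.\<close>

definition permanent :: "('a \<Rightarrow> 'b \<Rightarrow> 'c::comm_semiring_1) \<Rightarrow> 'a set \<Rightarrow> 'b set \<Rightarrow> 'c" where
  "permanent K X Z = (\<Sum>\<sigma> | \<sigma> \<in> extensional X \<and> bij_betw \<sigma> X Z. \<Prod>x\<in>X. K x (\<sigma> x))"

lemma permanent_empty [simp]:
  fixes K :: "'a \<Rightarrow> 'b \<Rightarrow> 'c::comm_semiring_1"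
  shows "permanent K {} {} = 1"
proof -
  have "{\<sigma>. \<sigma> \<in> extensional {} \<and> bij_betw \<sigma> {} ({} :: 'b set)} = {\<lambda>x::'a. undefined}"
    by (auto simp: bij_betw_def)
  then show ?thesis
    unfolding permanent_def by (simp only:) simp
qed

lemma permanent_transpose: "permanent K X Z = permanent (\<lambda>z x. K x z) Z X"
proof -
  let ?B = "\<lambda>(X :: 'x set) (Z :: 'y set). {\<sigma>. \<sigma> \<in> extensional X \<and> bij_betw \<sigma> X Z}"
  let ?inv = "\<lambda>X Z \<sigma>. restrict (inv_into X \<sigma>) Z"
  have flip: "?inv X Z \<sigma> \<in> extensional Z \<and> bij_betw (?inv X Z \<sigma>) Z X"
    "?inv Z X (?inv X Z \<sigma>) = \<sigma>"
    if "\<sigma> \<in> extensional X" "bij_betw \<sigma> X Z" for \<sigma> :: "'p \<Rightarrow> 'q" and X Z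
  proof -
    have b: "bij_betw (?inv X Z \<sigma>) Z X"
      using bij_betw_inv_into[OF that(2)] by (simp add: bij_betw_restrict_eq)
    then show "?inv X Z \<sigma> \<in> extensional Z \<and> bij_betw (?inv X Z \<sigma>) Z X"
      by simp
    show "?inv Z X (?inv X Z \<sigma>) = \<sigma>"
    proof (rule extensionalityI[OF restrict_extensional that(1)])
      fix x assume x: "x \<in> X"
      then have "\<sigma> x \<in> Z" "?inv X Z \<sigma> (\<sigma> x) = x"
        using that(2) by (auto simp: bij_betw_def)
      then show "?inv Z X (?inv X Z \<sigma>) x = \<sigma> x"
        using x inv_into_f_eq[of "?inv X Z \<sigma>" Z "\<sigma> x" x] b by (auto simp: bij_betw_def)
    qed
  qed
  show ?thesis
    unfolding permanent_def
  proof (rule sum.reindex_bij_witness[of _ "?inv Z X" "?inv X Z"])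
    fix \<sigma> assume "\<sigma> \<in> {\<sigma>. \<sigma> \<in> extensional X \<and> bij_betw \<sigma> X Z}"
    then have e: "\<sigma> \<in> extensional X" and b: "bij_betw \<sigma> X Z" by auto
    show "?inv Z X (?inv X Z \<sigma>) = \<sigma>" by (rule flip(2)[OF e b])
    show "?inv X Z \<sigma> \<in> {\<sigma>. \<sigma> \<in> extensional Z \<and> bij_betw \<sigma> Z X}" using flip(1)[OF e b] by simp
    have "(\<Prod>x\<in>X. K x (\<sigma> x)) = (\<Prod>x\<in>X. K (?inv X Z \<sigma> (\<sigma> x)) (\<sigma> x))"
      using b by (intro prod.cong refl) (auto simp: bij_betw_def)
    also have "\<dots> = (\<Prod>z\<in>Z. K (?inv X Z \<sigma> z) z)"
      by (rule prod.reindex_bij_betw[OF b])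
    finally show "(\<Prod>z\<in>Z. K (?inv X Z \<sigma> z) z) = (\<Prod>x\<in>X. K x (\<sigma> x))" by simp
  next
    fix \<sigma> assume "\<sigma> \<in> {\<sigma>. \<sigma> \<in> extensional Z \<and> bij_betw \<sigma> Z X}"
    then have e: "\<sigma> \<in> extensional Z" and b: "bij_betw \<sigma> Z X" by auto
    show "?inv X Z (?inv Z X \<sigma>) = \<sigma>" by (rule flip(2)[OF e b])
    show "?inv Z X \<sigma> \<in> {\<sigma>. \<sigma> \<in> extensional X \<and> bij_betw \<sigma> X Z}" using flip(1)[OF e b] by simp
  qed
qed

lemma permanent_expand_row:
  assumes "finite X" "finite Z" "x \<in> X"
  shows "permanent K X Z = (\<Sum>a\<in>Z. K x a * permanent K (X - {x}) (Z - {a}))"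
proof -
  let ?B = "\<lambda>X Z. {\<sigma>. \<sigma> \<in> extensional X \<and> bij_betw \<sigma> X Z}"
  have fin: "finite (?B (X - {x}) (Z - {a}))" for a
    by (rule finite_subset[OF _ finite_PiE[of "X - {x}" "\<lambda>_. Z"]])
       (use assms in \<open>auto simp: bij_betw_def PiE_def\<close>)
  have "permanent K X Z =
      (\<Sum>(a, \<tau>)\<in>Sigma Z (\<lambda>a. ?B (X - {x}) (Z - {a})). K x a * (\<Prod>y\<in>X - {x}. K y (\<tau> y)))"
    unfolding permanent_def
  proof (rule sum.reindex_bij_witness[of _ "\<lambda>(a, \<tau>). \<tau>(x := a)"
        "\<lambda>\<sigma>. (\<sigma> x, restrict \<sigma> (X - {x}))"])
    fix \<sigma> assume "\<sigma> \<in> ?B X Z"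
    then have e: "\<sigma> \<in> extensional X" and b: "bij_betw \<sigma> X Z" by auto
    show "(case (\<sigma> x, restrict \<sigma> (X - {x})) of (a, \<tau>) \<Rightarrow> \<tau>(x := a)) = \<sigma>"
      using e by (auto simp: fun_eq_iff extensional_def)
    have "bij_betw \<sigma> (X - {x}) (Z - {\<sigma> x})"
      using b assms(3) by (auto simp: bij_betw_def inj_on_def)
    then show "(\<sigma> x, restrict \<sigma> (X - {x})) \<in> Sigma Z (\<lambda>a. ?B (X - {x}) (Z - {a}))"
      using b assms(3) by (auto simp: bij_betw_restrict_eq bij_betw_def)
    show "(case (\<sigma> x, restrict \<sigma> (X - {x})) of (a, \<tau>) \<Rightarrow> K x a * (\<Prod>y\<in>X - {x}. K y (\<tau> y)))
        = (\<Prod>y\<in>X. K y (\<sigma> y))"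
      using assms by (simp add: prod.remove)
  next
    fix p assume p: "p \<in> Sigma Z (\<lambda>a. ?B (X - {x}) (Z - {a}))"
    obtain a \<tau> where [simp]: "p = (a, \<tau>)" by fastforce
    have a: "a \<in> Z" and e: "\<tau> \<in> extensional (X - {x})" and b: "bij_betw \<tau> (X - {x}) (Z - {a})"
      using p by auto
    show "((case p of (a, \<tau>) \<Rightarrow> \<tau>(x := a)) x, restrict (case p of (a, \<tau>) \<Rightarrow> \<tau>(x := a)) (X - {x})) = p"
      using e by (auto simp: fun_eq_iff extensional_def)
    have "bij_betw (\<tau>(x := a)) (insert x (X - {x})) (insert a (Z - {a}))"
      using b by (auto simp: bij_betw_def inj_on_def)
    then show "(case p of (a, \<tau>) \<Rightarrow> \<tau>(x := a)) \<in> ?B X Z"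
      using e a assms(3) by (auto simp: insert_absorb extensional_def)
  qed
  also have "\<dots> = (\<Sum>a\<in>Z. K x a * permanent K (X - {x}) (Z - {a}))"
    unfolding permanent_def sum_distrib_left
    by (rule sum.Sigma[symmetric]) (use assms fin in auto)
  finally show ?thesis .
qed

lemma permanent_expand_column:
  assumes "finite X" "finite Z" "a \<in> Z"
  shows "permanent K X Z = (\<Sum>x\<in>X. K x a * permanent K (X - {x}) (Z - {a}))"
  using permanent_expand_row[OF assms(2,1,3), of "\<lambda>z x. K x z"]
  by (simp add: permanent_transpose[of K])

lemma permanent_scale:
  assumes "card X = n"
  shows "permanent (\<lambda>x z. c * K x z) X Z = c ^ n * permanent K X Z"
  unfolding permanent_def by (simp add: prod.distrib assms sum_distrib_left)

definition cauchy_perm :: "complex set \<Rightarrow> complex set \<Rightarrow> complex" where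
  "cauchy_perm X Z = permanent (\<lambda>x a. 1 / (x - a)) X Z"

lemma cauchy_perm_empty [simp]: "cauchy_perm {} {} = 1"
  by (simp add: cauchy_perm_def)

lemma cauchy_perm_row:
  assumes "finite Y" "finite Z" "x \<notin> Y"
  shows "cauchy_perm (insert x Y) Z = (\<Sum>a\<in>Z. cauchy_perm Y (Z - {a}) / (x - a))"
  using permanent_expand_row[of "insert x Y" Z x "\<lambda>x a. 1 / (x - a)"] assms
  by (simp add: cauchy_perm_def)

lemma cauchy_perm_column:
  assumes "finite X" "finite Z" "a \<in> Z"
  shows "cauchy_perm X Z = (\<Sum>x\<in>X. cauchy_perm (X - {x}) (Z - {a}) / (x - a))"
  using permanent_expand_column[OF assms, of "\<lambda>x a. 1 / (x - a)"]
  by (simp add: cauchy_perm_def)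

lemma cauchy_perm_swap: "cauchy_perm Z X = (-1) ^ card X * cauchy_perm X Z"
proof -
  have "cauchy_perm Z X = permanent (\<lambda>x z. 1 / (z - x)) X Z"
    unfolding cauchy_perm_def by (subst permanent_transpose) simp
  also have "(\<lambda>x z. 1 / (z - x)) = (\<lambda>x z. - 1 * (1 / (x - z)) :: complex)"
    by (simp add: fun_eq_iff) (metis minus_diff_eq minus_divide_right)
  finally show ?thesis
    by (simp only: permanent_scale[OF refl] cauchy_perm_def)
qed

lemma cnj_cauchy_perm:
  "\<lbrakk>finite X; finite Z\<rbrakk> \<Longrightarrow> cnj (cauchy_perm X Z) = cauchy_perm (cnj ` X) (cnj ` Z)"
proof (induction X arbitrary: Z rule: finite_induct)
  case empty
  show ?case
    by (cases "Z = {}") (auto simp: cauchy_perm_def permanent_def bij_betw_def)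
next
  case (insert x X)
  have "cnj (cauchy_perm (insert x X) Z)
      = (\<Sum>a\<in>Z. cauchy_perm (cnj ` X) (cnj ` (Z - {a})) / (cnj x - cnj a))"
    using insert by (simp add: cauchy_perm_row)
  also have "\<dots> = (\<Sum>a\<in>cnj ` Z. cauchy_perm (cnj ` X) (cnj ` Z - {a}) / (cnj x - a))"
    by (subst sum.reindex) (auto simp: inj_on_def image_set_diff[of cnj] intro!: sum.cong)
  also have "\<dots> = cauchy_perm (cnj ` insert x X) (cnj ` Z)"
    using insert by (subst image_insert, subst cauchy_perm_row) auto
  finally show ?case .
qed

section \<open>Rational functions with only double poles\<close>

lemma lagrange_interpolation:
  fixes R :: "'a::field poly"
  assumes "finite Z" "degree R < card Z"
  shows "poly R x = (\<Sum>a\<in>Z. poly R a / (\<Prod>b\<in>Z - {a}. a - b) * (\<Prod>b\<in>Z - {a}. x - b))"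
proof -
  define S where "S = (\<Sum>a\<in>Z. smult (poly R a / (\<Prod>b\<in>Z - {a}. a - b)) (\<Prod>b\<in>Z - {a}. [:- b, 1:]))"
  have "R = S"
  proof (rule poly_eqI_degree[where A = Z])
    fix a assume a: "a \<in> Z"
    have "poly S a = (\<Sum>c\<in>Z. if c = a then poly R a else 0)"
      unfolding S_def poly_sum
      using a assms(1) by (intro sum.cong) (auto simp: poly_prod)
    then show "poly R a = poly S a"
      using a assms(1) by simp
  next
    have "degree (\<Prod>b\<in>Z - {a}. [:- b, 1:]) \<le> card Z - 1" if "a \<in> Z" for a
      using degree_prod_sum_le[of "Z - {a}" "\<lambda>b. [:- b, 1:]"] assms(1) that by simp
    then have "degree S \<le> card Z - 1"
      unfolding S_def
      by (intro degree_sum_le assms(1)) (use degree_smult_le order_trans in blast)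
    then show "degree S < card Z"
      using assms by linarith
  qed (fact assms)
  then have "poly R x = poly S x"
    by simp
  then show ?thesis
    by (simp add: S_def poly_sum poly_prod)
qed

lemma partial_fractions:
  fixes R :: "'a::field poly"
  assumes "finite Z" "degree R < card Z" "x \<notin> Z"
  shows "poly R x / (\<Prod>a\<in>Z. x - a) = (\<Sum>a\<in>Z. poly R a / (\<Prod>b\<in>Z - {a}. a - b) / (x - a))"
proof -
  have nz: "(\<Prod>a\<in>Z. x - a) \<noteq> 0"
    using assms by auto
  have "(\<Prod>b\<in>Z - {a}. x - b) / (\<Prod>a\<in>Z. x - a) = 1 / (x - a)" if "a \<in> Z" for a
    using that assms nz by (simp add: prod.remove[of Z a] field_simps)
  then have "c * (\<Prod>b\<in>Z - {a}. x - b) / (\<Prod>a\<in>Z. x - a) = c / (x - a)" if "a \<in> Z" for a c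
    using that by (metis (no_types) mult.right_neutral times_divide_eq_right)
  then show ?thesis
    unfolding lagrange_interpolation[OF assms(1,2), of x] sum_divide_distrib
    by (intro sum.cong refl) blast
qed

lemma DERIV_prod_linear:
  fixes x :: "'a::real_normed_field"
  assumes "finite Y" "x \<notin> Y"
  shows "((\<lambda>x. \<Prod>y\<in>Y. x - y) has_field_derivative (\<Prod>y\<in>Y. x - y) * (\<Sum>y\<in>Y. 1 / (x - y))) (at x)"
  using assms
proof (induction Y rule: finite_induct)
  case empty
  then show ?case by simp
next
  case (insert y Y)
  then show ?case
    by (auto intro!: derivative_eq_intros simp: field_simps)
qed

text \<open>The sum is the value at \<open>a\<close> of the regular part of \<open>\<Prod>(x - y)/\<Prod>(x - b)\<close>, and the identity comes from differentiating
the Lagrange interpolation formula of \<open>\<Prod>(x - y)\<close> at \<open>a\<close>.\<close>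

lemma lagrange_weights_sum:
  fixes Z Y :: "'a::real_normed_field set"
  defines "w \<equiv> \<lambda>a. (\<Prod>y\<in>Y. a - y) / (\<Prod>b\<in>Z - {a}. a - b)"
  assumes "finite Z" "finite Y" "card Y < card Z" "Y \<inter> Z = {}" "a \<in> Z"
  shows "(\<Sum>b\<in>Z - {a}. w b / (a - b)) = w a * ((\<Sum>y\<in>Y. 1 / (a - y)) - (\<Sum>b\<in>Z - {a}. 1 / (a - b)))"
proof -
  let ?R = "\<Prod>y\<in>Y. [:- y, 1:]"
  let ?D = "\<Prod>b\<in>Z - {a}. a - b"
  have nz: "?D \<noteq> 0"
    using assms by auto
  have deg: "degree ?R < card Z"
    using degree_prod_sum_le[of Y "\<lambda>b. [:- b, 1:]"] assms by simp
  \<comment> \<open>Every summand of the interpolation formula except the one for \<open>a\<close> contains the factor \<open>x - a\<close>,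
    so the derivative of their sum at \<open>a\<close> is the value there of the cofactor, called \<open>S\<close> below.\<close>
  have R: "(\<Prod>y\<in>Y. x - y) = w a * (\<Prod>b\<in>Z - {a}. x - b)
      + (x - a) * (\<Sum>b\<in>Z - {a}. w b * (\<Prod>c\<in>Z - {a} - {b}. x - c))" for x
  proof -
    have "(\<Prod>y\<in>Y. x - y) = (\<Sum>b\<in>Z. w b * (\<Prod>c\<in>Z - {b}. x - c))"
      using lagrange_interpolation[OF assms(2) deg, of x] by (simp add: poly_prod w_def)
    also have "\<dots> = w a * (\<Prod>b\<in>Z - {a}. x - b) + (\<Sum>b\<in>Z - {a}. w b * (\<Prod>c\<in>Z - {b}. x - c))"
      using assms by (simp add: sum.remove)
    also have "(\<Sum>b\<in>Z - {a}. w b * (\<Prod>c\<in>Z - {b}. x - c))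
        = (x - a) * (\<Sum>b\<in>Z - {a}. w b * (\<Prod>c\<in>Z - {a} - {b}. x - c))"
      unfolding sum_distrib_left
    proof (intro sum.cong refl)
      fix b assume "b \<in> Z - {a}"
      then have "(\<Prod>c\<in>Z - {b}. x - c) = (x - a) * (\<Prod>c\<in>Z - {b} - {a}. x - c)"
        using assms by (intro prod.remove) auto
      moreover have "Z - {b} - {a} = Z - {a} - {b}" by blast
      ultimately show "w b * (\<Prod>c\<in>Z - {b}. x - c) = (x - a) * (w b * (\<Prod>c\<in>Z - {a} - {b}. x - c))"
        by simp
    qed
    finally show ?thesis .
  qed
  define S where "S = (\<lambda>x. \<Sum>b\<in>Z - {a}. w b * (\<Prod>c\<in>Z - {a} - {b}. x - c))"
  obtain S' where S': "(S has_field_derivative S') (at a)"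
  proof
    have "(\<lambda>x. \<Prod>c\<in>Z - {a} - {b}. x - c) field_differentiable at a" for b
      using DERIV_prod_linear[of "Z - {a} - {b}" a] assms(2) field_differentiable_def by blast
    then have "S field_differentiable at a"
      unfolding S_def by (intro field_differentiable_sum field_differentiable_mult field_differentiable_const)
    then show "(S has_field_derivative deriv S a) (at a)"
      by (simp add: DERIV_deriv_iff_field_differentiable)
  qed
  have "((\<lambda>x. w a * (\<Prod>b\<in>Z - {a}. x - b) + (x - a) * S x) has_field_derivative
      w a * (?D * (\<Sum>b\<in>Z - {a}. 1 / (a - b))) + S a) (at a)"
    by (rule DERIV_cong[OF DERIV_add[OF DERIV_cmult[OF DERIV_prod_linear]
          DERIV_mult[OF DERIV_diff[OF DERIV_ident DERIV_const] S']]])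
       (use assms in simp_all)
  moreover have "((\<lambda>x. \<Prod>y\<in>Y. x - y) has_field_derivative (\<Prod>y\<in>Y. a - y) * (\<Sum>y\<in>Y. 1 / (a - y))) (at a)"
    using assms by (intro DERIV_prod_linear) auto
  moreover have "(\<lambda>x. \<Prod>y\<in>Y. x - y) = (\<lambda>x. w a * (\<Prod>b\<in>Z - {a}. x - b) + (x - a) * S x)"
    by (rule ext) (simp only: S_def R[symmetric])
  ultimately have "(\<Prod>y\<in>Y. a - y) * (\<Sum>y\<in>Y. 1 / (a - y)) = w a * (?D * (\<Sum>b\<in>Z - {a}. 1 / (a - b))) + S a"
    by (metis DERIV_unique)
  moreover have "S a = ?D * (\<Sum>b\<in>Z - {a}. w b / (a - b))"
    unfolding S_def sum_distrib_left
  proof (intro sum.cong refl)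
    fix b assume b: "b \<in> Z - {a}"
    then have "?D = (a - b) * (\<Prod>c\<in>Z - {a} - {b}. a - c)"
      using assms by (intro prod.remove) auto
    moreover have "a - b \<noteq> 0"
      using b by auto
    ultimately show "w b * (\<Prod>c\<in>Z - {a} - {b}. a - c) = ?D * (w b / (a - b))"
      by simp
  qed
  moreover have "(\<Prod>y\<in>Y. a - y) = w a * ?D"
    using nz by (simp add: w_def)
  ultimately have "?D * (\<Sum>b\<in>Z - {a}. w b / (a - b))
      = ?D * (w a * ((\<Sum>y\<in>Y. 1 / (a - y)) - (\<Sum>b\<in>Z - {a}. 1 / (a - b))))"
    by (simp add: algebra_simps)
  then show ?thesis
    using nz by simp
qed

text \<open>Both permanents are expanded along the one column in which they differ, that of \<open>a\<close> or of \<open>b\<close>; the remaining minors agree,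
and the entries differ by a multiple of \<open>a - b\<close>.\<close>

lemma cauchy_perm_difference:
  assumes "finite Z" "finite Y" "Y \<inter> Z = {}" "a \<in> Z" "b \<in> Z" "a \<noteq> b"
  shows "(cauchy_perm Y (Z - {b}) - cauchy_perm Y (Z - {a})) / (a - b)
    = (\<Sum>y\<in>Y. cauchy_perm (Y - {y}) (Z - {a} - {b}) / ((y - a) * (y - b)))"
proof -
  have "Z - {b} - {a} = Z - {a} - {b}" by blast
  then have "cauchy_perm Y (Z - {b}) = (\<Sum>y\<in>Y. cauchy_perm (Y - {y}) (Z - {a} - {b}) / (y - a))"
    using assms cauchy_perm_column[of Y "Z - {b}" a] by simp
  moreover have "cauchy_perm Y (Z - {a}) = (\<Sum>y\<in>Y. cauchy_perm (Y - {y}) (Z - {a} - {b}) / (y - b))"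
    using assms cauchy_perm_column[of Y "Z - {a}" b] by simp
  ultimately have "(cauchy_perm Y (Z - {b}) - cauchy_perm Y (Z - {a})) / (a - b)
    = (\<Sum>y\<in>Y. (cauchy_perm (Y - {y}) (Z - {a} - {b}) / (y - a)
        - cauchy_perm (Y - {y}) (Z - {a} - {b}) / (y - b)) / (a - b))"
    by (simp only: sum_subtractf sum_divide_distrib[symmetric])
  also have "\<dots> = (\<Sum>y\<in>Y. cauchy_perm (Y - {y}) (Z - {a} - {b}) / ((y - a) * (y - b)))"
  proof (intro sum.cong refl)
    fix y assume "y \<in> Y"
    then have "y - a \<noteq> 0" "y - b \<noteq> 0" "a - b \<noteq> 0"
      using assms by auto
    then show "(cauchy_perm (Y - {y}) (Z - {a} - {b}) / (y - a)
        - cauchy_perm (Y - {y}) (Z - {a} - {b}) / (y - b)) / (a - b)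
        = cauchy_perm (Y - {y}) (Z - {a} - {b}) / ((y - a) * (y - b))"
      by (simp add: divide_simps) (simp add: algebra_simps)
  qed
  finally show ?thesis .
qed

text \<open>After exchanging the two sums, the inner one is again a row expansion of the same permanent.\<close>

lemma cauchy_perm_difference_sum:
  assumes "finite Z" "finite Y" "Y \<inter> Z = {}" "a \<in> Z"
  shows "(\<Sum>b\<in>Z - {a}. (cauchy_perm Y (Z - {b}) - cauchy_perm Y (Z - {a})) / (a - b))
    = (\<Sum>y\<in>Y. 1 / (y - a)) * cauchy_perm Y (Z - {a})"
proof -
  have "(\<Sum>b\<in>Z - {a}. (cauchy_perm Y (Z - {b}) - cauchy_perm Y (Z - {a})) / (a - b))
     = (\<Sum>b\<in>Z - {a}. \<Sum>y\<in>Y. cauchy_perm (Y - {y}) (Z - {a} - {b}) / ((y - a) * (y - b)))"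
    by (intro sum.cong refl cauchy_perm_difference) (use assms in auto)
  also have "\<dots> = (\<Sum>y\<in>Y. 1 / (y - a) * (\<Sum>b\<in>Z - {a}. cauchy_perm (Y - {y}) (Z - {a} - {b}) / (y - b)))"
    unfolding sum_distrib_left by (subst sum.swap) simp
  also have "\<dots> = (\<Sum>y\<in>Y. 1 / (y - a) * cauchy_perm Y (Z - {a}))"
  proof (intro sum.cong refl)
    fix y assume "y \<in> Y"
    then show "1 / (y - a) * (\<Sum>b\<in>Z - {a}. cauchy_perm (Y - {y}) (Z - {a} - {b}) / (y - b))
      = 1 / (y - a) * cauchy_perm Y (Z - {a})"
      using cauchy_perm_row[of "Y - {y}" "Z - {a}" y] assms by (simp add: insert_absorb)
  qed
  finally show ?thesis
    by (simp add: sum_distrib_right)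
qed

text \<open>This replaces Borchardt's identity. Both factors on the right have simple poles at \<open>Z\<close>, with residues \<open>w a\<close> and \<open>p a\<close>, so
the double-pole part is as claimed and only the absence of simple poles needs an argument. The residue at
\<open>a\<close> of the product is \<open>\<Sum>\<^sub>b (w a * p b + w b * p a)/(a - b)\<close>; by the lemmas on the weights \<open>w\<close> and
on the minors \<open>p\<close>, the two halves add up to
\<open>w a * p a\<close> times \<open>\<Sum>\<^sub>y 1/(y - a) + \<Sum>\<^sub>y 1/(a - y) = 0\<close>. For \<open>x \<notin> Y\<close> the sum on the right is the permanent of \<open>insert x Y\<close>.\<close>

lemma double_pole_expansion:
  fixes Z Y :: "complex set"
  defines "w \<equiv> \<lambda>a. (\<Prod>y\<in>Y. a - y) / (\<Prod>b\<in>Z - {a}. a - b)"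
    and "p \<equiv> \<lambda>a. cauchy_perm Y (Z - {a})"
  assumes "finite Z" "finite Y" "card Y < card Z" "Y \<inter> Z = {}" "x \<notin> Z"
  shows "(\<Sum>a\<in>Z. w a * p a / (x - a)^2)
    = (\<Prod>y\<in>Y. x - y) / (\<Prod>a\<in>Z. x - a) * (\<Sum>a\<in>Z. p a / (x - a))"
proof -
  have "degree (\<Prod>y\<in>Y. [:- y, 1:]) < card Z"
    using degree_prod_sum_le[of Y "\<lambda>b. [:- b, 1:]"] assms by simp
  from partial_fractions[OF assms(3) this assms(7)]
  have "(\<Prod>y\<in>Y. x - y) / (\<Prod>a\<in>Z. x - a) = (\<Sum>a\<in>Z. w a / (x - a))"
    by (simp add: w_def poly_prod)
  then have "(\<Prod>y\<in>Y. x - y) / (\<Prod>a\<in>Z. x - a) * (\<Sum>a\<in>Z. p a / (x - a))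
      = (\<Sum>a\<in>Z. \<Sum>b\<in>Z. w a / (x - a) * (p b / (x - b)))"
    by (simp add: sum_product)
  also have "\<dots> = (\<Sum>a\<in>Z. w a * p a / (x - a)^2 + (\<Sum>b\<in>Z - {a}. w a / (x - a) * (p b / (x - b))))"
    using assms(3) by (intro sum.cong) (auto simp: sum.remove power2_eq_square)
  also have "\<dots> = (\<Sum>a\<in>Z. w a * p a / (x - a)^2)
      + (\<Sum>a\<in>Z. \<Sum>b\<in>Z - {a}. w a / (x - a) * (p b / (x - b)))"
    by (rule sum.distrib)
  also have "(\<Sum>a\<in>Z. \<Sum>b\<in>Z - {a}. w a / (x - a) * (p b / (x - b))) = 0"
  proof -
    have "(\<Sum>a\<in>Z. \<Sum>b\<in>Z - {a}. w a / (x - a) * (p b / (x - b)))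
        = (\<Sum>a\<in>Z. \<Sum>b\<in>Z - {a}. w a * p b / (a - b) / (x - a) - w a * p b / (a - b) / (x - b))"
    proof (intro sum.cong refl)
      fix a b assume "a \<in> Z" "b \<in> Z - {a}"
      then have "x - a \<noteq> 0" "x - b \<noteq> 0" "a - b \<noteq> 0"
        using assms(7) by auto
      then show "w a / (x - a) * (p b / (x - b)) = w a * p b / (a - b) / (x - a) - w a * p b / (a - b) / (x - b)"
        by (simp add: divide_simps) (simp add: algebra_simps)
    qed
    also have "\<dots> = (\<Sum>a\<in>Z. \<Sum>b\<in>Z - {a}. w a * p b / (a - b) / (x - a))
        - (\<Sum>a\<in>Z. \<Sum>b\<in>Z - {a}. w a * p b / (a - b) / (x - b))"
      by (simp add: sum_subtractf)
    also have "(\<Sum>a\<in>Z. \<Sum>b\<in>Z - {a}. w a * p b / (a - b) / (x - b))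
        = (\<Sum>b\<in>Z. \<Sum>a\<in>Z - {b}. w a * p b / (a - b) / (x - b))"
      using sum.swap_restrict[of Z Z "\<lambda>a b. w a * p b / (a - b) / (x - b)" "\<lambda>a b. a \<noteq> b"] assms(3)
      by (simp add: set_diff_eq eq_commute)
    also have "(\<Sum>a\<in>Z. \<Sum>b\<in>Z - {a}. w a * p b / (a - b) / (x - a))
        - (\<Sum>b\<in>Z. \<Sum>a\<in>Z - {b}. w a * p b / (a - b) / (x - b))
        = (\<Sum>a\<in>Z. (\<Sum>b\<in>Z - {a}. w a * p b / (a - b) + w b * p a / (a - b)) / (x - a))"
      unfolding sum_subtractf[symmetric] sum_divide_distrib
    proof (intro sum.cong refl)
      fix a b assume "a \<in> Z" "b \<in> Z - {a}"
      then have "w b * p a / (b - a) = - (w b * p a / (a - b))"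
        by (metis minus_diff_eq minus_divide_right)
      then show "w a * p b / (a - b) / (x - a) - w b * p a / (b - a) / (x - a)
          = (w a * p b / (a - b) + w b * p a / (a - b)) / (x - a)"
        by (simp add: add_divide_distrib)
    qed
    also have "\<dots> = 0"
    proof (intro sum.neutral ballI)
      fix a assume a: "a \<in> Z"
      have "(\<Sum>b\<in>Z - {a}. w a * p b / (a - b) + w b * p a / (a - b))
          = w a * (\<Sum>b\<in>Z - {a}. (p b - p a) / (a - b)) + w a * p a * (\<Sum>b\<in>Z - {a}. 1 / (a - b))
            + p a * (\<Sum>b\<in>Z - {a}. w b / (a - b))"
        by (simp add: sum_distrib_left sum.distrib[symmetric] algebra_simps diff_divide_distrib)
      also have "\<dots> = w a * p a * ((\<Sum>y\<in>Y. 1 / (y - a)) + (\<Sum>y\<in>Y. 1 / (a - y)))"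
      proof -
        have P: "(\<Sum>b\<in>Z - {a}. (p b - p a) / (a - b)) = (\<Sum>y\<in>Y. 1 / (y - a)) * p a"
          unfolding p_def by (rule cauchy_perm_difference_sum) (use a assms in auto)
        have W: "(\<Sum>b\<in>Z - {a}. w b / (a - b))
            = w a * ((\<Sum>y\<in>Y. 1 / (a - y)) - (\<Sum>b\<in>Z - {a}. 1 / (a - b)))"
          unfolding w_def by (rule lagrange_weights_sum) (use a assms in auto)
        show ?thesis
          unfolding P W by (simp only: algebra_simps)
      qed
      also have "(\<Sum>y\<in>Y. 1 / (y - a)) = - (\<Sum>y\<in>Y. 1 / (a - y))"
        unfolding sum_negf[symmetric] by (intro sum.cong refl) (metis minus_diff_eq minus_divide_right)
      finally show "(\<Sum>b\<in>Z - {a}. w a * p b / (a - b) + w b * p a / (a - b)) / (x - a) = 0"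
        by simp
    qed
    finally show ?thesis .
  qed
  finally show ?thesis
    by simp
qed

section \<open>The sign of the Cauchy permanent\<close>

text \<open>The expression is affine in \<open>\<alpha>\<close>, and at the end points \<open>\<alpha> = m\<close> and \<open>\<alpha> = -m\<close> it factors into positive terms.\<close>

lemma bilinear_pos:
  fixes x y \<alpha> m :: real
  assumes "\<bar>x\<bar> < m" "\<bar>y\<bar> < m" "\<bar>\<alpha>\<bar> \<le> m"
  shows "x * y - (x + y) * \<alpha> + m\<^sup>2 > 0"
proof -
  have e: "2 * m * (x * y - (x + y) * \<alpha> + m\<^sup>2)
      = (m + \<alpha>) * ((m - x) * (m - y)) + (m - \<alpha>) * ((m + x) * (m + y))"
    by (simp add: algebra_simps power2_eq_square)
  have p: "(m - x) * (m - y) > 0" "(m + x) * (m + y) > 0"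
    using assms by (auto intro!: mult_pos_pos)
  have m: "m > 0"
    using assms by linarith
  have "(m + \<alpha>) * ((m - x) * (m - y)) + (m - \<alpha>) * ((m + x) * (m + y)) > 0"
  proof (cases "\<alpha> = m")
    case True
    then show ?thesis using p m by simp
  next
    case False
    then have "m + \<alpha> \<ge> 0" "m - \<alpha> > 0"
      using assms by auto
    then show ?thesis
      using p by (intro add_nonneg_pos mult_nonneg_nonneg[OF _ less_imp_le] mult_pos_pos[of "m - \<alpha>"])
  qed
  then have "0 < 2 * m * (x * y - (x + y) * \<alpha> + m\<^sup>2)"
    by (simp only: e)
  then show ?thesis
    by (rule zero_less_mult_pos) (use m in simp)
qed

lemma Re_conjugate_pair_pos:
  assumes "\<bar>x\<bar> \<le> r" "\<bar>y\<bar> \<le> r" "r < cmod a"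
  shows "Re (1 / ((of_real x - a) * (of_real y - cnj a))) > 0"
proof -
  have "Re ((of_real x - a) * (of_real y - cnj a)) = x * y - (x + y) * Re a + (cmod a)\<^sup>2"
    by (simp add: cmod_power2) (simp add: algebra_simps power2_eq_square)
  also have "\<dots> > 0"
    using assms abs_Re_le_cmod[of a] by (intro bilinear_pos) auto
  finally show ?thesis
    by (simp only: Re_complex_div_gt_0 mult_1 cnj.sel(1))
qed

text \<open>Induction on \<open>Z\<close>, removing a real point or a conjugate pair. A real point contributes entries of one sign, since the
nodes all lie on the same side of it. For a pair, the two columns are expanded together: the minors are real by
induction, so the real part of the permanent is a combination of these minors with the coefficients of
\<open>Re_conjugate_pair_pos\<close>, and the imaginary part vanishes by symmetry under conjugation.\<close>

lemma cauchy_perm_constant_sign: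
  assumes "finite Z" "cnj ` Z = Z" "\<And>a. a \<in> Z \<Longrightarrow> r < cmod a"
  shows "\<exists>s\<in>{1, -1::real}. \<forall>X. finite X \<longrightarrow> card X = card Z \<longrightarrow> X \<subseteq> {-r..r} \<longrightarrow>
    (\<exists>p>0. cauchy_perm (of_real ` X) Z = of_real (s * p))"
  using assms
proof (induction "card Z" arbitrary: Z rule: less_induct)
  case less
  note fin = \<open>finite Z\<close> and sym = \<open>cnj ` Z = Z\<close> and out = less.prems(3)
  have of_real_remove: "of_real ` X - {of_real x} = (of_real ` (X - {x}) :: complex set)" for X and x :: real
    by auto
  consider (empty) "Z = {}" | (real) \<alpha> where "of_real \<alpha> \<in> Z"
    | (pair) a where "a \<in> Z" "Im a \<noteq> 0"
    using complex_is_Real_iff by (metis Reals_cases all_not_in_conv)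
  then show ?case
  proof cases
    case empty
    have "\<exists>p>0. cauchy_perm (of_real ` X) Z = of_real (1 * p)" if "finite X" "card X = card Z" for X :: "real set"
      using that empty by (intro exI[of _ 1]) auto
    then show ?thesis
      by blast
  next
    case real
    let ?Z = "Z - {of_real \<alpha>}"
    have sym': "cnj ` ?Z = ?Z"
      using sym by (auto simp: image_set_diff inj_on_def)
    have out': "r < cmod b" if "b \<in> ?Z" for b
      using out that by blast
    obtain s where s: "s \<in> {1, -1}" and "\<forall>X. finite X \<longrightarrow> card X = card ?Z \<longrightarrow> X \<subseteq> {-r..r} \<longrightarrow>
        (\<exists>p>0. cauchy_perm (of_real ` X) ?Z = of_real (s * p))"
      using less.hyps[OF card_Diff1_less[OF fin real] finite_Diff[OF fin] sym' out'] by blast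
    then obtain p where p: "p X > 0" "cauchy_perm (of_real ` X) ?Z = of_real (s * p X)"
      if "finite X" "card X = card ?Z" "X \<subseteq> {-r..r}" for X
      by metis
    have \<alpha>: "\<bar>\<alpha>\<bar> > r"
      using out[OF real] by simp
    let ?s = "if \<alpha> > 0 then - s else s"
    have "\<exists>p>0. cauchy_perm (of_real ` X) Z = of_real (?s * p)"
      if X: "finite X" "card X = card Z" "X \<subseteq> {-r..r}" for X
    proof (intro exI conjI)
      have P: "p (X - {x}) > 0" "cauchy_perm (of_real ` (X - {x})) ?Z = of_real (s * p (X - {x}))"
        if "x \<in> X" for x
      proof -
        have "finite (X - {x})" "card (X - {x}) = card ?Z" "X - {x} \<subseteq> {-r..r}"
          using that X real fin by auto
        then show "p (X - {x}) > 0" "cauchy_perm (of_real ` (X - {x})) ?Z = of_real (s * p (X - {x}))"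
          by (rule p)+
      qed
      have ne: "x \<noteq> \<alpha>" if "x \<in> X" for x
        using subsetD[OF X(3) that] \<alpha> by auto
      have "X \<noteq> {}"
        using X real fin by auto
      moreover have pos: "p (X - {x}) / \<bar>x - \<alpha>\<bar> > 0" if "x \<in> X" for x
        using P(1)[OF that] ne[OF that] by simp
      ultimately show "(\<Sum>x\<in>X. p (X - {x}) / \<bar>x - \<alpha>\<bar>) > 0"
        using X by (intro sum_pos) auto
      have "cauchy_perm (of_real ` X) Z
          = (\<Sum>x\<in>X. cauchy_perm (of_real ` (X - {x})) ?Z / (of_real x - of_real \<alpha>))"
        using cauchy_perm_column[of "of_real ` X" Z "of_real \<alpha>"] X fin real
        by (simp add: sum.reindex inj_on_def of_real_remove)
      also have "\<dots> = (\<Sum>x\<in>X. of_real (?s * (p (X - {x}) / \<bar>x - \<alpha>\<bar>)))"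
      proof (intro sum.cong refl)
        fix x assume x: "x \<in> X"
        have "\<bar>x - \<alpha>\<bar> = (if \<alpha> > 0 then \<alpha> - x else x - \<alpha>)" "x \<noteq> \<alpha>"
          using subsetD[OF X(3) x] ne[OF x] \<alpha> by auto
        then have "s * p (X - {x}) / (x - \<alpha>) = ?s * (p (X - {x}) / \<bar>x - \<alpha>\<bar>)"
          by (auto simp: field_simps)
        then show "cauchy_perm (of_real ` (X - {x})) ?Z / (of_real x - of_real \<alpha>)
            = of_real (?s * (p (X - {x}) / \<bar>x - \<alpha>\<bar>))"
          unfolding P(2)[OF x] by (metis of_real_diff of_real_divide)
      qed
      finally show "cauchy_perm (of_real ` X) Z = of_real (?s * (\<Sum>x\<in>X. p (X - {x}) / \<bar>x - \<alpha>\<bar>))"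
        by (simp only: of_real_sum sum_distrib_left)
    qed
    moreover have "?s \<in> {1, -1}"
      using s by auto
    ultimately show ?thesis
      by blast
  next
    case pair
    let ?Z = "Z - {a} - {cnj a}"
    have a: "cnj a \<in> Z - {a}"
      using sym pair by (auto simp: complex_eq_iff image_iff)
    then have card2: "card Z = Suc (Suc (card ?Z))"
      using fin pair by (metis card.remove finite_Diff)
    then have less_card: "card ?Z < card Z"
      by simp
    have sym': "cnj ` ?Z = ?Z"
      using sym by (auto simp: image_set_diff inj_on_def)
    have out': "r < cmod b" if "b \<in> ?Z" for b
      using out that by blast
    obtain s where s: "s \<in> {1, -1}" and "\<forall>X. finite X \<longrightarrow> card X = card ?Z \<longrightarrow> X \<subseteq> {-r..r} \<longrightarrow>
        (\<exists>p>0. cauchy_perm (of_real ` X) ?Z = of_real (s * p))"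
      using less.hyps[OF less_card finite_Diff[OF finite_Diff[OF fin]] sym' out'] by blast
    then obtain p where p: "p X > 0" "cauchy_perm (of_real ` X) ?Z = of_real (s * p X)"
      if "finite X" "card X = card ?Z" "X \<subseteq> {-r..r}" for X
      by metis
    have "\<exists>p>0. cauchy_perm (of_real ` X) Z = of_real (s * p)"
      if X: "finite X" "card X = card Z" "X \<subseteq> {-r..r}" for X
    proof (intro exI conjI)
      let ?q = "\<lambda>x y. 1 / ((of_real x - a) * (of_real y - cnj a))"
      let ?p = "\<Sum>x\<in>X. \<Sum>y\<in>X - {x}. p (X - {x} - {y}) * Re (?q x y)"
      have P: "p (X - {x} - {y}) > 0"
        "cauchy_perm (of_real ` (X - {x} - {y})) ?Z = of_real (s * p (X - {x} - {y}))"
        if "x \<in> X" "y \<in> X - {x}" for x y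
      proof -
        have "finite (X - {x} - {y})" "card (X - {x} - {y}) = card ?Z" "X - {x} - {y} \<subseteq> {-r..r}"
          using that X card2 by auto
        then show "p (X - {x} - {y}) > 0"
          "cauchy_perm (of_real ` (X - {x} - {y})) ?Z = of_real (s * p (X - {x} - {y}))"
          by (rule p)+
      qed
      show "?p > 0"
      proof (intro sum_pos mult_pos_pos P Re_conjugate_pair_pos[of _ r])
        show "X \<noteq> {}"
          using X card2 by auto
        show "X - {x} \<noteq> {}" if "x \<in> X" for x
          using X card2 that by (metis One_nat_def card.empty card_Diff_singleton diff_Suc_1 nat.distinct(1))
      qed (use X out[OF pair(1)] in \<open>auto simp: subset_eq abs_le_iff\<close>)
      have "cauchy_perm (of_real ` X) Z
          = (\<Sum>x\<in>X. cauchy_perm (of_real ` (X - {x})) (Z - {a}) / (of_real x - a))"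
        using cauchy_perm_column[of "of_real ` X" Z a] X fin pair
        by (simp add: sum.reindex inj_on_def of_real_remove)
      also have "\<dots> = (\<Sum>x\<in>X. \<Sum>y\<in>X - {x}. cauchy_perm (of_real ` (X - {x} - {y})) ?Z * ?q x y)"
      proof (intro sum.cong refl)
        fix x assume "x \<in> X"
        have "cauchy_perm (of_real ` (X - {x})) (Z - {a})
          = (\<Sum>y\<in>X - {x}. cauchy_perm (of_real ` (X - {x} - {y})) ?Z / (of_real y - cnj a))"
          using cauchy_perm_column[of "of_real ` (X - {x})" "Z - {a}" "cnj a"] X fin a
          by (simp add: sum.reindex inj_on_def of_real_remove)
        then show "cauchy_perm (of_real ` (X - {x})) (Z - {a}) / (of_real x - a)
          = (\<Sum>y\<in>X - {x}. cauchy_perm (of_real ` (X - {x} - {y})) ?Z * ?q x y)"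
          by (simp add: sum_divide_distrib mult.commute)
      qed
      also have "\<dots> = (\<Sum>x\<in>X. \<Sum>y\<in>X - {x}. of_real s * (of_real (p (X - {x} - {y})) * ?q x y))"
        by (intro sum.cong refl) (simp only: P(2) of_real_mult mult.assoc)
      finally have "Re (cauchy_perm (of_real ` X) Z)
          = (\<Sum>x\<in>X. \<Sum>y\<in>X - {x}. Re (of_real s * (of_real (p (X - {x} - {y})) * ?q x y)))"
        by (simp only: Re_sum)
      also have "\<dots> = s * ?p"
        unfolding sum_distrib_left
      proof (intro sum.cong refl)
        fix x y
        show "Re (of_real s * (of_real (p (X - {x} - {y})) * ?q x y)) = s * (p (X - {x} - {y}) * Re (?q x y))"
          by (simp only: times_complex.sel Re_complex_of_real Im_complex_of_real mult_zero_left diff_0_right)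
      qed
      finally have "Re (cauchy_perm (of_real ` X) Z) = s * ?p" .
      moreover have "cnj (cauchy_perm (of_real ` X) Z) = cauchy_perm (of_real ` X) Z"
        using cnj_cauchy_perm[of "of_real ` X" Z] X fin sym by (simp add: image_image)
      ultimately show "cauchy_perm (of_real ` X) Z = of_real (s * ?p)"
        by (simp add: complex_eq_iff)
    qed
    then show ?thesis
      using s by blast
  qed
qed

lemma cauchy_perm_nonzero:
  assumes "finite Z" "cnj ` Z = Z" "\<And>a. a \<in> Z \<Longrightarrow> r < cmod a"
    and "finite X" "card X = card Z" "X \<subseteq> {-r..r}"
  shows "cauchy_perm (of_real ` X) Z \<noteq> 0"
proof -
  obtain s p where "s \<in> {1, -1::real}" "p > 0" "cauchy_perm (of_real ` X) Z = of_real (s * p)"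
    using cauchy_perm_constant_sign[OF assms(1-3)] assms(4-6) by blast
  then show ?thesis
    by auto
qed

section \<open>Chebyshev properties of the double poles\<close>

text \<open>The expansion with poles \<open>T\<close> and nodes \<open>Z\<close>, evaluated at the node \<open>a\<close>, where its right-hand side vanishes. Its weights carry the
Cauchy permanents of \<open>T - {t}\<close> and \<open>Z\<close>, which all have the same sign, so the sign of \<open>\<mu> t\<close> is that of the remaining
denominator and alternates along \<open>T\<close>.\<close>

lemma double_pole_alternating_relation:
  fixes T :: "real set"
  assumes "finite Z" "cnj ` Z = Z" "\<And>a. a \<in> Z \<Longrightarrow> r < cmod a"
    and "finite T" "card T = Suc (card Z)" "T \<subseteq> {-r..r}"
  obtains \<mu> where "\<And>t. t \<in> T \<Longrightarrow> \<mu> t * (\<Prod>u\<in>T - {t}. t - u) > 0"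
    and "\<And>a. a \<in> Z \<Longrightarrow> (\<Sum>t\<in>T. of_real (\<mu> t) * (\<Prod>b\<in>Z. of_real t - b) / (of_real t - a)\<^sup>2) = 0"
proof -
  obtain s where s: "s \<in> {1, -1::real}" and "\<forall>X. finite X \<longrightarrow> card X = card Z \<longrightarrow> X \<subseteq> {-r..r} \<longrightarrow>
    (\<exists>p>0. cauchy_perm (of_real ` X) Z = of_real (s * p))"
    using cauchy_perm_constant_sign[OF assms(1-3)] by blast
  then obtain p where p: "p X > 0" "cauchy_perm (of_real ` X) Z = of_real (s * p X)"
    if "finite X" "card X = card Z" "X \<subseteq> {-r..r}" for X
    by metis
  have pt: "p (T - {t}) > 0" "cauchy_perm Z (of_real ` (T - {t})) = (-1) ^ card Z * of_real s * of_real (p (T - {t}))"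
    if "t \<in> T" for t
    using p[of "T - {t}"] that assms(4-6)
    by (auto simp: cauchy_perm_swap[of Z] card_image inj_on_def)
  let ?D = "\<lambda>t. \<Prod>u\<in>T - {t}. t - u"
  show ?thesis
  proof
    fix t assume t: "t \<in> T"
    then show "p (T - {t}) / ?D t * ?D t > 0"
      using pt assms(4) by simp
  next
    fix a assume a: "a \<in> Z"
    have disj: "Z \<inter> of_real ` T = {}"
      using assms(3,6) by (force simp: abs_le_iff)
    have "(\<Sum>t\<in>of_real ` T. (\<Prod>y\<in>Z. t - y) / (\<Prod>b\<in>of_real ` T - {t}. t - b)
        * cauchy_perm Z (of_real ` T - {t}) / (a - t)\<^sup>2) = 0"
      using double_pole_expansion[of "of_real ` T" Z a] assms disj a
      by (force simp: card_image inj_on_def prod_zero_iff)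
    moreover have "of_real ` T - {of_real t} = (of_real ` (T - {t}) :: complex set)" for t
      by auto
    ultimately have "0 = (\<Sum>t\<in>T. (\<Prod>y\<in>Z. of_real t - y) / of_real (?D t)
        * cauchy_perm Z (of_real ` (T - {t})) / (a - of_real t)\<^sup>2)"
      by (simp add: sum.reindex prod.reindex inj_on_def)
    also have "\<dots> = (\<Sum>t\<in>T. (-1) ^ card Z * of_real s *
        (of_real (p (T - {t}) / ?D t) * (\<Prod>b\<in>Z. of_real t - b) / (of_real t - a)\<^sup>2))"
      by (intro sum.cong refl) (simp add: pt(2) power2_commute[of a])
    also have "\<dots> = (-1) ^ card Z * of_real s *
        (\<Sum>t\<in>T. of_real (p (T - {t}) / ?D t) * (\<Prod>b\<in>Z. of_real t - b) / (of_real t - a)\<^sup>2)"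
      by (simp only: sum_distrib_left)
    finally show "(\<Sum>t\<in>T. of_real (p (T - {t}) / ?D t) * (\<Prod>b\<in>Z. of_real t - b) / (of_real t - a)\<^sup>2) = 0"
      using s by auto
  qed
qed

text \<open>The dual basis is explicit: the expansion with poles \<open>T\<close> and nodes \<open>Z - {a}\<close> gives weights for which the weighted sum of
values on \<open>T\<close> annihilates every \<open>1/(x - b)\<^sup>2\<close> with \<open>b \<noteq> a\<close>; on \<open>1/(x - a)\<^sup>2\<close> it is a nonzero multiple of the Cauchy permanent of
\<open>T\<close> and \<open>Z\<close>.\<close>

lemma double_pole_independent:
  fixes T :: "real set"
  assumes "finite Z" "cnj ` Z = Z" "\<And>a. a \<in> Z \<Longrightarrow> r < cmod a"
    and "finite T" "card T = card Z" "T \<subseteq> {-r..r}"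
    and zero: "\<And>t. t \<in> T \<Longrightarrow> (\<Sum>a\<in>Z. c a / (of_real t - a)\<^sup>2) = 0"
    and "a \<in> Z"
  shows "c a = 0"
proof -
  let ?T = "of_real ` T :: complex set" and ?Y = "Z - {a}"
  define w where "w = (\<lambda>t::complex. (\<Prod>y\<in>?Y. t - y) / (\<Prod>b\<in>?T - {t}. t - b) * cauchy_perm ?Y (?T - {t}))"
  have disj: "Z \<inter> ?T = {}"
    using assms(3,6) by (force simp: abs_le_iff)
  have "card Z > 0"
    using assms by (auto simp: card_gt_0_iff)
  then have w: "(\<Sum>t\<in>?T. w t / (b - t)\<^sup>2) = (\<Prod>y\<in>?Y. b - y) / (\<Prod>t\<in>?T. b - t) * (\<Sum>t\<in>?T. cauchy_perm ?Y (?T - {t}) / (b - t))"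
    if "b \<in> Z" for b
    unfolding w_def
    by (intro double_pole_expansion) (use assms disj that in \<open>auto simp: card_image inj_on_def\<close>)
  have other: "(\<Sum>t\<in>?T. w t / (b - t)\<^sup>2) = 0" if "b \<in> ?Y" for b
    using w[of b] that assms(1) by auto
  have "(\<Sum>t\<in>?T. cauchy_perm ?Y (?T - {t}) / (a - t)) = cauchy_perm Z ?T"
    using cauchy_perm_row[of ?Y ?T a] assms by (simp add: insert_absorb)
  also have "\<dots> \<noteq> 0"
    using cauchy_perm_nonzero[of Z r T] assms by (simp add: cauchy_perm_swap[of Z ?T])
  finally have own: "(\<Sum>t\<in>?T. w t / (a - t)\<^sup>2) \<noteq> 0"
    using w[of a] assms disj by auto
  have "0 = (\<Sum>t\<in>?T. w t * (\<Sum>b\<in>Z. c b / (t - b)\<^sup>2))"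
    by (intro sum.neutral[symmetric]) (use zero in auto)
  also have "\<dots> = (\<Sum>b\<in>Z. c b * (\<Sum>t\<in>?T. w t / (b - t)\<^sup>2))"
    unfolding sum_distrib_left by (subst sum.swap) (simp add: power2_commute mult.commute)
  also have "\<dots> = c a * (\<Sum>t\<in>?T. w t / (a - t)\<^sup>2)"
    using assms(1,8) other by (simp add: sum.remove)
  finally show ?thesis
    using own by simp
qed

section \<open>Alternation or separation of two compact sets\<close>

text \<open>Induction on \<open>k\<close>: let \<open>b\<close> be the first point of \<open>B\<close>. To the right of \<open>b\<close> the roles are exchanged and the chains
are shorter by one, since a point of \<open>A\<close> can be put in front of any chain; one further separating point is placed between \<open>b\<close> and the
last point of \<open>A\<close> before it. The bounds \<open>lo\<close>, \<open>hi\<close> keep the points found by induction to the right of \<open>b\<close>.\<close>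

lemma alternation_or_separation:
  fixes A B :: "real set"
  assumes "compact A" "compact B" "A \<inter> B = {}" "A \<union> B \<subseteq> {lo..hi}"
    and "\<And>b. b \<in> B \<Longrightarrow> \<exists>a\<in>A. a < b"
    and "\<nexists>t. strict_mono_on {..k} t \<and> (\<forall>i\<le>k. t i \<in> (if even i then A else B))"
  shows "\<exists>Y. finite Y \<and> card Y \<le> k - 1 \<and> Y \<subseteq> {lo<..<hi} \<and>
    (\<forall>x\<in>A. (\<Prod>y\<in>Y. y - x) > 0) \<and> (\<forall>x\<in>B. (\<Prod>y\<in>Y. y - x) < 0)"
  using assms
proof (induction k arbitrary: A B lo)
  case 0
  have "A = {}"
  proof (rule ccontr)
    assume "A \<noteq> {}"
    then obtain a where "a \<in> A" by blast
    then have "strict_mono_on {..0::nat} (\<lambda>_. a) \<and> (\<forall>i\<le>0::nat. a \<in> (if even i then A else B))"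
      by (auto simp: strict_mono_on_def)
    then show False
      using 0(6) by blast
  qed
  then show ?case
    using 0(5) by (intro exI[of _ "{}"]) auto
next
  case (Suc k)
  show ?case
  proof (cases "B = {}")
    case True
    then show ?thesis
      by (intro exI[of _ "{}"]) auto
  next
    case False
    then obtain b where b: "b \<in> B" "\<And>x. x \<in> B \<Longrightarrow> b \<le> x"
      using compact_attains_inf[OF Suc.prems(2)] by blast
    let ?A = "A \<inter> {b..}"
    have no_chain: "\<nexists>t. strict_mono_on {..k} t \<and> (\<forall>i\<le>k. t i \<in> (if even i then B else ?A))"
    proof (intro notI, elim exE conjE)
      fix t assume t: "strict_mono_on {..k} t" "\<forall>i\<le>k. t i \<in> (if even i then B else ?A)"
      then have "t 0 \<in> B"
        by (metis even_zero zero_le)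
      then obtain a where a: "a \<in> A" "a < t 0"
        using Suc.prems(5) by blast
      have "a < t i" if "i \<le> k" for i
      proof (cases "i = 0")
        case False
        then have "t 0 < t i"
          using t(1) that by (auto simp: strict_mono_on_def)
        then show ?thesis using a by simp
      qed (use a in simp)
      then have "strict_mono_on {..Suc k} (case_nat a t)"
        using t(1) by (auto simp: strict_mono_on_def split: nat.splits)
      moreover have "\<forall>i\<le>Suc k. case_nat a t i \<in> (if even i then A else B)"
        using t(2) a by (auto split: nat.splits if_splits)
      ultimately show False
        using Suc.prems(6) by blast
    qed
    have "k \<noteq> 0"
    proof
      assume "k = 0"
      then have "strict_mono_on {..k} (\<lambda>_. b) \<and> (\<forall>i\<le>k. b \<in> (if even i then B else ?A))"
        using b by (auto simp: strict_mono_on_def)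
      then show False
        using no_chain by blast
    qed
    have below: "\<exists>b'\<in>B. b' < a" if "a \<in> ?A" for a
    proof
      show "b < a"
        using that b Suc.prems(3) by (metis IntD1 IntD2 IntI atLeast_iff empty_iff order_le_less)
    qed (rule b(1))
    have sub: "B \<union> ?A \<subseteq> {b..hi}"
      using b Suc.prems(4) by auto
    obtain Y where Y: "finite Y" "card Y \<le> k - 1" "Y \<subseteq> {b<..<hi}"
      "\<And>x. x \<in> B \<Longrightarrow> (\<Prod>y\<in>Y. y - x) > 0" "\<And>x. x \<in> ?A \<Longrightarrow> (\<Prod>y\<in>Y. y - x) < 0"
      using Suc.IH[OF Suc.prems(2) compact_Int_closed[OF Suc.prems(1) closed_atLeast] _ sub below no_chain]
        Suc.prems(3) by blast
    obtain a0 where a0: "a0 \<in> A" "a0 < b"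
      using Suc.prems(5) b(1) by blast
    have "compact (A \<inter> {..b})" "A \<inter> {..b} \<noteq> {}"
      using compact_Int_closed[OF Suc.prems(1) closed_atMost] a0 by auto
    from compact_attains_sup[OF this]
    obtain a where a: "a \<in> A" "a \<le> b" "\<And>x. x \<in> A \<Longrightarrow> x \<le> b \<Longrightarrow> x \<le> a"
      by auto
    have "a < b"
      using a b Suc.prems(3) by (metis IntI empty_iff order_le_less)
    define m where "m = (a + b) / 2"
    have m: "a < m" "m < b"
      using \<open>a < b\<close> by (auto simp: m_def)
    then have "m \<notin> Y"
      using Y(3) by auto
    then have prod: "(\<Prod>y\<in>insert m Y. y - x) = (m - x) * (\<Prod>y\<in>Y. y - x)" for x
      using Y(1) by simp
    show ?thesis
    proof (intro exI conjI ballI)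
      show "finite (insert m Y)" "card (insert m Y) \<le> Suc k - 1"
        using Y(1,2) \<open>m \<notin> Y\<close> \<open>k \<noteq> 0\<close> by auto
      have "lo \<le> a" "b \<le> hi"
        using a(1) b(1) Suc.prems(4) by auto
      then show "insert m Y \<subseteq> {lo<..<hi}"
        using m Y(3) \<open>a < b\<close> by auto
    next
      fix x assume x: "x \<in> B"
      then have "m - x < 0"
        using b(2)[OF x] m by simp
      then show "(\<Prod>y\<in>insert m Y. y - x) < 0"
        unfolding prod using Y(4)[OF x] by (rule mult_neg_pos)
    next
      fix x assume x: "x \<in> A"
      show "(\<Prod>y\<in>insert m Y. y - x) > 0"
      proof (cases "b \<le> x")
        case True
        then show ?thesis
          unfolding prod using m x by (intro mult_neg_neg Y(5)) auto
      next
        case False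
        then have "x < m"
          using a(3)[OF x] m by auto
        moreover have "(\<Prod>y\<in>Y. y - x) > 0"
          using Y(3) False by (intro prod_pos) auto
        ultimately show ?thesis
          unfolding prod by simp
      qed
    qed
  qed
qed

section \<open>Logarithmic derivatives of monic polynomials\<close>

definition monic_poly :: "complex multiset \<Rightarrow> complex poly" where
  "monic_poly W = (\<Prod>a\<in>#W. [:- a, 1:])"

lemma monic_poly_add: "monic_poly (add_mset a W) = [:- a, 1:] * monic_poly W"
  by (simp add: monic_poly_def)

lemma poly_monic_poly: "poly (monic_poly W) x = (\<Prod>a\<in>#W. x - a)"
proof (induction W)
  case (add a W)
  then show ?case
    unfolding monic_poly_add poly_mult by simp
qed (simp add: monic_poly_def)

lemma poly_monic_poly_eq_0_iff: "poly (monic_poly W) x = 0 \<longleftrightarrow> x \<in># W"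
  by (auto simp: poly_monic_poly prod_mset_zero_iff)

lemma degree_monic_poly: "degree (monic_poly W) = size W"
  and lead_coeff_monic_poly: "coeff (monic_poly W) (size W) = 1"
proof -
  have "degree (monic_poly W) = size W \<and> lead_coeff (monic_poly W) = 1"
  proof (induction W)
    case (add a W)
    have "monic_poly W \<noteq> 0" "[:- a, 1:] \<noteq> 0"
      using add by auto
    then have "degree (monic_poly (add_mset a W)) = degree [:- a, 1:] + degree (monic_poly W)"
      unfolding monic_poly_add by (rule degree_mult_eq[rotated])
    moreover have "lead_coeff (monic_poly (add_mset a W)) = lead_coeff [:- a, 1:] * lead_coeff (monic_poly W)"
      unfolding monic_poly_add by (rule lead_coeff_mult)
    ultimately show ?case
      using add by (elim conjE) simp
  qed (simp add: monic_poly_def)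
  then show "degree (monic_poly W) = size W" "coeff (monic_poly W) (size W) = 1"
    by auto
qed

lemma poly_pderiv_monic_poly:
  "x \<notin># W \<Longrightarrow> poly (pderiv (monic_poly W)) x = poly (monic_poly W) x * log_deriv W x"
proof (induction W)
  case (add a W)
  then have x: "x - a \<noteq> 0" and IH: "poly (pderiv (monic_poly W)) x = poly (monic_poly W) x * log_deriv W x"
    by auto
  have "poly (pderiv (monic_poly (add_mset a W))) x
      = poly [:- a, 1:] x * poly (pderiv (monic_poly W)) x + poly (monic_poly W) x * poly (pderiv [:- a, 1:]) x"
    unfolding monic_poly_add pderiv_mult by (simp only: poly_add poly_mult)
  also have "\<dots> = (x - a) * (poly (monic_poly W) x * log_deriv W x) + poly (monic_poly W) x"
    unfolding IH by (simp add: pderiv_pCons)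
  also have "\<dots> = (x - a) * poly (monic_poly W) x * (1 / (x - a) + log_deriv W x)"
    using x by (simp add: distrib_left)
  also have "(x - a) * poly (monic_poly W) x = poly (monic_poly (add_mset a W)) x"
    unfolding monic_poly_add poly_mult by simp
  also have "1 / (x - a) + log_deriv W x = log_deriv (add_mset a W) x"
    by (simp add: log_deriv_def)
  finally show ?case .
qed (simp add: monic_poly_def log_deriv_def)

lemma monic_poly_constant_sign:
  assumes "real_poles W" "\<And>x. x \<in> {-1..1} \<Longrightarrow> of_real x \<notin># W"
  obtains s :: real where "s \<in> {1, -1}"
    "\<And>x. x \<in> {-1..1} \<Longrightarrow> \<exists>q>0. poly (monic_poly W) (of_real x) = of_real (s * q)"
proof -
  have cnj_poly: "cnj (\<Prod>a\<in>#Y. of_real x - a) = (\<Prod>a\<in>#image_mset cnj Y. of_real x - a)" for Y and x :: real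
    by (induction Y) auto
  define h where "h = (\<lambda>x::real. Re (poly (monic_poly W) (of_real x)))"
  have h: "poly (monic_poly W) (of_real x) = of_real (h x)" for x
  proof -
    have "cnj (poly (monic_poly W) (of_real x)) = poly (monic_poly W) (of_real x)"
      using assms(1) unfolding poly_monic_poly cnj_poly real_poles_def by simp
    then show ?thesis
      by (simp add: h_def complex_eq_iff)
  qed
  have "continuous_on {-1..1} h"
    unfolding h_def by (intro continuous_intros)
  then have conn: "connected (h ` {-1..1})"
    by (rule connected_continuous_image) simp
  have nz: "0 \<notin> h ` {-1..1}"
    using assms(2) h poly_monic_poly_eq_0_iff by (metis imageE of_real_0)
  define s :: real where "s = (if h 0 > 0 then 1 else -1)"
  show ?thesis
  proof
    show "s \<in> {1, -1}"
      by (auto simp: s_def)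
    fix x :: real assume x: "x \<in> {-1..1}"
    have "s * h x > 0"
    proof (rule ccontr)
      assume neg: "\<not> s * h x > 0"
      have mem: "h x \<in> h ` {-1..1}" "h 0 \<in> h ` {-1..1}"
        using x by auto
      have "h 0 \<noteq> 0" "h x \<noteq> 0"
        using nz mem by metis+
      then consider "h x \<le> 0" "0 \<le> h 0" | "h 0 \<le> 0" "0 \<le> h x"
        using neg by (auto simp: s_def split: if_splits)
      then have "0 \<in> h ` {-1..1}"
        using connectedD_interval[OF conn] mem by metis
      with nz show False ..
    qed
    moreover have "h x = s * (s * h x)"
      by (simp add: s_def)
    ultimately show "\<exists>q>0. poly (monic_poly W) (of_real x) = of_real (s * q)"
      using h[of x] by metis
  qed
qed

text \<open>This is \<open>(Q/P)' = Q/P * (Q'/Q - P'/P)\<close> for \<open>Q = monic_poly W\<close>, with \<open>Q/P\<close> written in partial fractions. If \<open>Q\<close> has the same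
degree as \<open>P\<close>, then \<open>P\<close> is first subtracted from it, which removes the leading term and does not affect the derivative of \<open>Q/P\<close>.\<close>

lemma log_deriv_difference:
  assumes "finite Z" "Z \<noteq> {}" "size W \<le> card Z" "x \<notin> Z" "x \<notin># W"
  shows "poly (monic_poly W) x * (log_deriv W x - log_deriv (mset_set Z) x) / (\<Prod>a\<in>Z. x - a)
    = - (\<Sum>a\<in>Z. poly (monic_poly W) a / (\<Prod>b\<in>Z - {a}. a - b) / (x - a)\<^sup>2)"
proof -
  let ?q = "monic_poly W" and ?p = "monic_poly (mset_set Z)"
  define k :: complex where "k = (if size W = card Z then 1 else 0)"
  define R where "R = ?q - smult k ?p"
  have "coeff R i = 0" if "i \<ge> card Z" for i
  proof (cases "i = card Z")
    case True
    then show ?thesis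
      using lead_coeff_monic_poly[of W] lead_coeff_monic_poly[of "mset_set Z"] assms(3)
      by (auto simp: R_def k_def coeff_eq_0 degree_monic_poly)
  next
    case False
    then show ?thesis
      using that assms(3) by (simp add: R_def coeff_eq_0 degree_monic_poly)
  qed
  moreover have "card Z > 0"
    using assms by (simp add: card_gt_0_iff)
  ultimately have deg: "degree R < card Z"
    by (intro degree_lessI) auto
  have p: "poly ?p y = (\<Prod>a\<in>Z. y - a)" for y
    by (simp add: poly_monic_poly prod_unfold_prod_mset)
  have p0: "poly ?p y \<noteq> 0" if "y \<notin> Z" for y
    using that assms(1) by (simp add: p)
  have w: "poly R a = poly ?q a" if "a \<in> Z" for a
    using that assms(1) by (simp add: R_def poly_monic_poly_eq_0_iff)
  let ?F = "\<lambda>y. k + (\<Sum>a\<in>Z. poly ?q a / (\<Prod>b\<in>Z - {a}. a - b) / (y - a))"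
  have eq: "poly ?q y / poly ?p y = ?F y" if "y \<notin> Z" for y
  proof -
    have "poly ?q y / poly ?p y = k + poly R y / poly ?p y"
      using p0[OF that] by (simp add: R_def field_simps)
    also have "poly R y / poly ?p y = (\<Sum>a\<in>Z. poly R a / (\<Prod>b\<in>Z - {a}. a - b) / (y - a))"
      unfolding p by (rule partial_fractions[OF assms(1) deg that])
    also have "\<dots> = (\<Sum>a\<in>Z. poly ?q a / (\<Prod>b\<in>Z - {a}. a - b) / (y - a))"
      by (intro sum.cong refl) (simp add: w)
    finally show ?thesis .
  qed
  have quot: "((\<lambda>y. poly ?q y / poly ?p y) has_field_derivative
      (poly (pderiv ?q) x * poly ?p x - poly ?q x * poly (pderiv ?p) x) / (poly ?p x * poly ?p x)) (at x)"
    by (intro DERIV_divide poly_DERIV p0 assms)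
  have "(?F has_field_derivative - (\<Sum>a\<in>Z. poly ?q a / (\<Prod>b\<in>Z - {a}. a - b) / (x - a)\<^sup>2)) (at x)"
  proof -
    have "((\<lambda>y. c / (y - a)) has_field_derivative - (c / (x - a)\<^sup>2)) (at x)" if "a \<in> Z" for a c
      using that assms(4) by (auto intro!: derivative_eq_intros simp: power2_eq_square)
    then have "(?F has_field_derivative 0 + (\<Sum>a\<in>Z. - (poly ?q a / (\<Prod>b\<in>Z - {a}. a - b) / (x - a)\<^sup>2))) (at x)"
      by (intro DERIV_add DERIV_const DERIV_sum)
    then show ?thesis
      by (simp add: sum_negf)
  qed
  moreover have "(?F has_field_derivative
      (poly (pderiv ?q) x * poly ?p x - poly ?q x * poly (pderiv ?p) x) / (poly ?p x * poly ?p x)) (at x)"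
    by (rule has_field_derivative_transform_within_open[OF quot, of "- Z"])
       (use assms eq in \<open>auto simp: finite_imp_closed open_Compl\<close>)
  ultimately have "(poly (pderiv ?q) x * poly ?p x - poly ?q x * poly (pderiv ?p) x) / (poly ?p x * poly ?p x)
      = - (\<Sum>a\<in>Z. poly ?q a / (\<Prod>b\<in>Z - {a}. a - b) / (x - a)\<^sup>2)"
    by (rule DERIV_unique[rotated])
  moreover have "poly (pderiv ?q) x = poly ?q x * log_deriv W x"
    "poly (pderiv ?p) x = poly ?p x * log_deriv (mset_set Z) x"
    using assms by (auto intro!: poly_pderiv_monic_poly)
  then have "poly ?q x * (log_deriv W x - log_deriv (mset_set Z) x) / poly ?p x
      = (poly (pderiv ?q) x * poly ?p x - poly ?q x * poly (pderiv ?p) x) / (poly ?p x * poly ?p x)"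
    using p0[OF assms(4)] by (simp add: field_simps)
  ultimately show ?thesis
    by (simp only: p)
qed

section \<open>Deviation and its first-order decrease\<close>

lemma continuous_on_log_deriv_real:
  "\<forall>x\<in>A. of_real x \<notin># Z \<Longrightarrow> continuous_on A (log_deriv_real Z)"
proof -
  have "\<forall>x\<in>A. of_real x \<notin># Z \<Longrightarrow> continuous_on A (\<lambda>x. log_deriv Z (of_real x))"
  proof (induction Z)
    case (add a Z)
    then show ?case
      by (auto simp: log_deriv_def intro!: continuous_intros)
  qed (simp add: log_deriv_def)
  then show "\<forall>x\<in>A. of_real x \<notin># Z \<Longrightarrow> continuous_on A (log_deriv_real Z)"
    unfolding log_deriv_real_def by (intro continuous_intros)
qed

lemma deviation_attained:
  assumes "continuous_on {-1..1} f" "\<And>x. x \<in> {-1..1} \<Longrightarrow> of_real x \<notin># Z"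
  obtains x where "x \<in> {-1..1}" "deviation f Z = ereal \<bar>f x - log_deriv_real Z x\<bar>"
    "\<And>y. y \<in> {-1..1} \<Longrightarrow> \<bar>f y - log_deriv_real Z y\<bar> \<le> \<bar>f x - log_deriv_real Z x\<bar>"
proof -
  have "continuous_on {-1..1} (\<lambda>x. \<bar>f x - log_deriv_real Z x\<bar>)"
    using assms by (intro continuous_intros continuous_on_log_deriv_real) auto
  then obtain x where x: "x \<in> {-1..1}"
    "\<And>y. y \<in> {-1..1} \<Longrightarrow> \<bar>f y - log_deriv_real Z y\<bar> \<le> \<bar>f x - log_deriv_real Z x\<bar>"
    using continuous_attains_sup[of "{-1..1::real}" "\<lambda>x. \<bar>f x - log_deriv_real Z x\<bar>"] by fastforce
  moreover have "deviation f Z = ereal \<bar>f x - log_deriv_real Z x\<bar>"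
    unfolding deviation_def using assms(2) x
    by (auto intro!: antisym SUP_least SUP_upper)
  ultimately show ?thesis
    using that by blast
qed

text \<open>The easy half of Kolmogorov's criterion: a direction \<open>g\<close> with \<open>e * g > 0\<close> wherever \<open>\<bar>e\<bar>\<close> is maximal decreases the maximum of \<open>\<bar>e\<bar>\<close>.
Otherwise, for steps tending to 0, there are points \<open>z\<close> at which the modulus is still at least \<open>d\<close>. There
\<open>e\<^sup>2 \<le> (e - h)\<^sup>2\<close>, that is \<open>2 e h \<le> h\<^sup>2\<close>; dividing by the step and passing to an accumulation point gives \<open>e * g \<le> 0\<close>
at an extremal point.\<close>

lemma first_order_improvement:
  fixes I :: "'a::metric_space set" and e g :: "'a \<Rightarrow> real"
  assumes "compact I" "continuous_on I e" "continuous_on I g"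
    and "\<And>x. x \<in> I \<Longrightarrow> \<bar>e x\<bar> \<le> d" "\<And>x. x \<in> I \<Longrightarrow> \<bar>e x\<bar> = d \<Longrightarrow> e x * g x > 0"
    and "\<tau>0 > 0"
    and h: "\<And>\<tau> x. \<lbrakk>0 < \<tau>; \<tau> < \<tau>0; x \<in> I\<rbrakk> \<Longrightarrow> \<bar>h \<tau> x - \<tau> * g x\<bar> \<le> M * \<tau>\<^sup>2"
  shows "\<exists>\<tau>>0. \<tau> < \<tau>0 \<and> (\<forall>x\<in>I. \<bar>e x - h \<tau> x\<bar> < d)"
proof (rule ccontr)
  assume no: "\<not> ?thesis"
  define \<tau> where "\<tau> = (\<lambda>n::nat. \<tau>0 / (real n + 2))"
  have \<tau>: "0 < \<tau> n" "\<tau> n < \<tau>0" for n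
    using \<open>\<tau>0 > 0\<close> by (auto simp: \<tau>_def field_simps add_strict_increasing)
  have \<tau>_lim: "\<tau> \<longlonglongrightarrow> 0"
    unfolding \<tau>_def by real_asymp
  have "\<exists>x\<in>I. d \<le> \<bar>e x - h (\<tau> n) x\<bar>" for n
    using no \<tau>[of n] by (meson not_le)
  then obtain x where x: "x n \<in> I" "d \<le> \<bar>e (x n) - h (\<tau> n) (x n)\<bar>" for n
    by metis
  obtain y r where y: "y \<in> I" "strict_mono (r :: nat \<Rightarrow> nat)" "(x \<circ> r) \<longlonglongrightarrow> y"
    using assms(1) x(1) unfolding compact_def by metis
  define t where "t = \<tau> \<circ> r"
  define z where "z = x \<circ> r"
  have t: "0 < t n" "t n < \<tau>0" and z: "z n \<in> I" "d \<le> \<bar>e (z n) - h (t n) (z n)\<bar>" for n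
    using \<tau> x by (auto simp: t_def z_def)
  have t_lim: "t \<longlonglongrightarrow> 0"
    unfolding t_def by (rule LIMSEQ_subseq_LIMSEQ[OF \<tau>_lim y(2)])
  have z_lim: "z \<longlonglongrightarrow> y"
    using y(3) by (simp add: z_def)
  have e_lim: "(\<lambda>n. e (z n)) \<longlonglongrightarrow> e y" and g_lim: "(\<lambda>n. g (z n)) \<longlonglongrightarrow> g y"
    by (rule continuous_on_tendsto_compose[OF assms(2) z_lim y(1)]
        continuous_on_tendsto_compose[OF assms(3) z_lim y(1)], simp add: z(1))+
  have slope: "(\<lambda>n. h (t n) (z n) / t n) \<longlonglongrightarrow> g y"
  proof -
    have "(\<lambda>n. h (t n) (z n) / t n - g (z n)) \<longlonglongrightarrow> 0"
    proof (rule Lim_null_comparison)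
      have "norm (h (t n) (z n) / t n - g (z n)) \<le> M * t n" for n
      proof -
        have "h (t n) (z n) / t n - g (z n) = (h (t n) (z n) - t n * g (z n)) / t n"
          using t(1)[of n] by (simp add: diff_divide_distrib)
        then have "norm (h (t n) (z n) / t n - g (z n)) = \<bar>h (t n) (z n) - t n * g (z n)\<bar> / t n"
          using t(1)[of n] by (simp add: abs_divide)
        also have "\<dots> \<le> M * (t n)\<^sup>2 / t n"
          by (rule divide_right_mono[OF h[OF t z(1)] less_imp_le[OF t(1)]])
        also have "\<dots> = M * t n"
          using t(1)[of n] by (simp add: power2_eq_square)
        finally show ?thesis .
      qed
      then show "\<forall>\<^sub>F n in sequentially. norm (h (t n) (z n) / t n - g (z n)) \<le> M * t n"
        by simp
      show "(\<lambda>n. M * t n) \<longlonglongrightarrow> 0"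
        using tendsto_mult_left[OF t_lim, of M] by simp
    qed
    from tendsto_add[OF this g_lim] show ?thesis by simp
  qed
  have h_lim: "(\<lambda>n. h (t n) (z n)) \<longlonglongrightarrow> 0"
  proof -
    have "h (t n) (z n) = h (t n) (z n) / t n * t n" for n
      using t(1)[of n] by simp
    then show ?thesis
      using tendsto_mult[OF slope t_lim] by simp
  qed
  have "d \<le> \<bar>e y - 0\<bar>"
    by (rule LIMSEQ_le_const[OF tendsto_rabs[OF tendsto_diff[OF e_lim h_lim]]]) (use z(2) in auto)
  then have "e y * g y > 0"
    using assms(4,5)[OF y(1)] by simp
  moreover have "2 * (e y * g y) \<le> 0 * g y"
  proof (rule LIMSEQ_le)
    show "(\<lambda>n. 2 * (e (z n) * (h (t n) (z n) / t n))) \<longlonglongrightarrow> 2 * (e y * g y)"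
      by (intro tendsto_intros e_lim slope)
    show "(\<lambda>n. h (t n) (z n) * (h (t n) (z n) / t n)) \<longlonglongrightarrow> 0 * g y"
      by (intro tendsto_intros h_lim slope)
    have "2 * (e (z n) * (h (t n) (z n) / t n)) \<le> h (t n) (z n) * (h (t n) (z n) / t n)" for n
    proof -
      have "\<bar>e (z n)\<bar> \<le> \<bar>e (z n) - h (t n) (z n)\<bar>"
        using assms(4)[OF z(1)[of n]] z(2)[of n] by linarith
      then have "(e (z n))\<^sup>2 \<le> (e (z n) - h (t n) (z n))\<^sup>2"
        by (simp add: abs_le_square_iff)
      then have "2 * (e (z n) * h (t n) (z n)) \<le> h (t n) (z n) * h (t n) (z n)"
        by (simp add: power2_eq_square algebra_simps)
      then show ?thesis
        using t(1)[of n] by (simp add: divide_right_mono)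
    qed
    then show "\<exists>N. \<forall>n\<ge>N. 2 * (e (z n) * (h (t n) (z n) / t n)) \<le> h (t n) (z n) * (h (t n) (z n) / t n)"
      by blast
  qed
  ultimately show False
    by simp
qed

section \<open>Moving the poles\<close>

lemma log_deriv_mset_set: "log_deriv (mset_set Z) x = (\<Sum>a\<in>Z. 1 / (x - a))"
  by (simp add: log_deriv_def sum_unfold_sum_mset)

lemma real_poles_mset_set:
  "cnj ` Z = Z \<Longrightarrow> real_poles (mset_set Z)"
  by (simp add: real_poles_def image_mset_mset_set inj_on_def)

text \<open>The coefficients are the products \<open>w a * p a\<close> of \<open>double_pole_expansion\<close>, up to sign. They respect conjugation, so poles moved along them stay symmetric. The points of \<open>Y\<close>
may lie anywhere in \<open>[-r,r]\<close>; placing some of them outside \<open>[-1,1]\<close> yields fewer sign changes there.\<close>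

lemma descent_direction:
  fixes Y :: "real set"
  assumes "finite Z" "cnj ` Z = Z" "\<And>a. a \<in> Z \<Longrightarrow> r < cmod a" "1 \<le> r"
    and "finite Y" "Y \<subseteq> {-r..r}" "Suc (card Y) = card Z"
  obtains c where "\<And>a. a \<in> Z \<Longrightarrow> c (cnj a) = cnj (c a)"
    and "\<And>x. \<lbrakk>x \<in> {-1..1}; x \<notin> Y\<rbrakk> \<Longrightarrow>
      \<exists>p>0. (\<Sum>a\<in>Z. c a / (of_real x - a)\<^sup>2) = of_real (p * (\<Prod>y\<in>Y. y - x))"
proof -
  let ?Y = "of_real ` Y :: complex set"
  have no_pole: "of_real x \<notin> Z" if "x \<in> {-r..r}" for x
    using assms(3)[of "of_real x"] that by (auto simp: abs_le_iff)
  obtain s where s: "s \<in> {1, -1::real}" and perm: "\<forall>X. finite X \<longrightarrow> card X = card Z \<longrightarrow> X \<subseteq> {-r..r} \<longrightarrow>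
    (\<exists>p>0. cauchy_perm (of_real ` X) Z = of_real (s * p))"
    using cauchy_perm_constant_sign[OF assms(1-3)] by blast
  obtain \<sigma> where \<sigma>: "\<sigma> \<in> {1, -1::real}" and "\<And>x. x \<in> {-1..1} \<Longrightarrow>
    \<exists>q>0. poly (monic_poly (mset_set Z)) (of_real x) = of_real (\<sigma> * q)"
    using monic_poly_constant_sign[OF real_poles_mset_set[OF assms(2)]] no_pole assms(1,4) by auto
  then have node: "\<exists>q>0. (\<Prod>a\<in>Z. of_real x - a) = of_real (\<sigma> * q)" if "x \<in> {-1..1}" for x
    using that by (simp add: poly_monic_poly prod_unfold_prod_mset)
  define w where "w = (\<lambda>a. (\<Prod>y\<in>?Y. a - y) / (\<Prod>b\<in>Z - {a}. a - b))"
  define v where "v = (\<lambda>a. cauchy_perm ?Y (Z - {a}))"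
  \<comment> \<open>The factors account for the signs of the permanent and of \<open>P\<close>, and for writing \<open>y - x\<close> instead of \<open>x - y\<close>.\<close>
  define k :: real where "k = s * \<sigma> * (-1) ^ card Y"
  have Y_cnj: "cnj ` ?Y = ?Y"
    by (simp add: image_image)
  have Z_cnj: "cnj ` (Z - {a}) = Z - {cnj a}" for a
    using assms(2) by (simp add: image_set_diff inj_on_def)
  show ?thesis
  proof
    fix a assume a: "a \<in> Z"
    have "cnj (v a) = v (cnj a)"
      unfolding v_def using cnj_cauchy_perm[of ?Y "Z - {a}"] assms(1,5) by (simp add: Y_cnj Z_cnj)
    moreover have "cnj (w a) = w (cnj a)"
    proof -
      have "(\<Prod>y\<in>?Y. cnj a - y) = (\<Prod>y\<in>cnj ` ?Y. cnj a - y)"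
        by (simp only: Y_cnj)
      also have "\<dots> = cnj (\<Prod>y\<in>?Y. a - y)"
        by (subst prod.reindex) (auto simp: inj_on_def)
      finally have num: "(\<Prod>y\<in>?Y. cnj a - y) = cnj (\<Prod>y\<in>?Y. a - y)" .
      have "(\<Prod>b\<in>Z - {cnj a}. cnj a - b) = (\<Prod>b\<in>cnj ` (Z - {a}). cnj a - b)"
        by (simp only: Z_cnj)
      also have "\<dots> = cnj (\<Prod>b\<in>Z - {a}. a - b)"
        by (subst prod.reindex) (auto simp: inj_on_def)
      finally show ?thesis
        unfolding w_def num by simp
    qed
    ultimately show "of_real k * (w (cnj a) * v (cnj a)) = cnj (of_real k * (w a * v a))"
      by simp
  next
    fix x assume x: "x \<in> {-1..1}" "x \<notin> Y"
    obtain q where q: "q > 0" "(\<Prod>a\<in>Z. of_real x - a) = of_real (\<sigma> * q)"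
      using node[OF x(1)] by blast
    have "insert x Y \<subseteq> {-r..r}"
      using x assms(4,6) by auto
    then obtain p where p: "p > 0" "cauchy_perm (of_real ` insert x Y) Z = of_real (s * p)"
      using perm x assms(5,7) by (metis card_insert_disjoint finite_insert)
    have disj: "?Y \<inter> Z = {}"
      using no_pole assms(6) by auto
    have "(\<Sum>a\<in>Z. w a * v a / (of_real x - a)\<^sup>2)
        = (\<Prod>y\<in>?Y. of_real x - y) / (\<Prod>a\<in>Z. of_real x - a) * (\<Sum>a\<in>Z. v a / (of_real x - a))"
      unfolding w_def v_def
      by (rule double_pole_expansion) (use assms disj no_pole x in \<open>auto simp: card_image inj_on_def\<close>)
    also have "(\<Sum>a\<in>Z. v a / (of_real x - a)) = of_real (s * p)"
      unfolding v_def p(2)[symmetric] image_insert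
      by (rule cauchy_perm_row[symmetric]) (use assms x in auto)
    also have "(\<Prod>y\<in>?Y. of_real x - y) = of_real (\<Prod>y\<in>Y. x - y)"
      by (simp add: prod.reindex inj_on_def)
    also have "(\<Prod>y\<in>Y. x - y) = (-1) ^ card Y * (\<Prod>y\<in>Y. y - x)"
      by (simp only: prod_constant[symmetric] prod.distrib[symmetric]) simp
    finally have sum: "(\<Sum>a\<in>Z. w a * v a / (of_real x - a)\<^sup>2)
        = of_real ((-1) ^ card Y * (\<Prod>y\<in>Y. y - x) / (\<sigma> * q) * (s * p))"
      unfolding q(2) by simp
    have "(\<Sum>a\<in>Z. of_real k * (w a * v a) / (of_real x - a)\<^sup>2)
        = of_real k * (\<Sum>a\<in>Z. w a * v a / (of_real x - a)\<^sup>2)"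
      by (simp add: sum_distrib_left)
    then have "(\<Sum>a\<in>Z. of_real k * (w a * v a) / (of_real x - a)\<^sup>2)
        = of_real (k * ((-1) ^ card Y * (\<Prod>y\<in>Y. y - x) / (\<sigma> * q) * (s * p)))"
      unfolding sum by (simp only: of_real_mult)
    also have "k * ((-1) ^ card Y * (\<Prod>y\<in>Y. y - x) / (\<sigma> * q) * (s * p))
        = (s * s) * (\<sigma> / \<sigma>) * ((-1) ^ card Y * (-1) ^ card Y) * (p / q * (\<Prod>y\<in>Y. y - x))"
      by (simp add: k_def)
    also have "\<dots> = p / q * (\<Prod>y\<in>Y. y - x)"
      using s \<sigma> by (auto simp: power_mult_distrib[symmetric])
    finally show "\<exists>p>0. (\<Sum>a\<in>Z. of_real k * (w a * v a) / (of_real x - a)\<^sup>2) = of_real (p * (\<Prod>y\<in>Y. y - x))"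
      using p(1) q(1) by (intro exI[of _ "p / q"]) simp
  qed
qed

text \<open>Moving each pole \<open>a\<close> by \<open>\<tau> * c a\<close> changes its term by \<open>h\<^sup>2/(D\<^sup>2 (D - h))\<close> beyond the linear part, where \<open>D = x - a\<close>
and \<open>h = \<tau> * c a\<close>. This is of order \<open>\<tau>\<^sup>2\<close> uniformly in \<open>x\<close>, since \<open>\<bar>D\<bar> \<ge> r - 1\<close> on \<open>[-1,1]\<close>.\<close>

lemma log_deriv_first_order:
  assumes "finite Z" "\<And>a. a \<in> Z \<Longrightarrow> r < cmod a" "1 < r"
  obtains \<tau>0 M where "\<tau>0 > 0"
    and "\<And>\<tau> x. \<lbrakk>0 < \<tau>; \<tau> < \<tau>0; x \<in> {-1..1}\<rbrakk> \<Longrightarrow>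
      of_real x \<notin># image_mset (\<lambda>a. a + of_real \<tau> * c a) (mset_set Z)"
    and "\<And>\<tau> x. \<lbrakk>0 < \<tau>; \<tau> < \<tau>0; x \<in> {-1..1}\<rbrakk> \<Longrightarrow>
      cmod (log_deriv (image_mset (\<lambda>a. a + of_real \<tau> * c a) (mset_set Z)) (of_real x)
        - log_deriv (mset_set Z) (of_real x) - of_real \<tau> * (\<Sum>a\<in>Z. c a / (of_real x - a)\<^sup>2)) \<le> M * \<tau>\<^sup>2"
proof -
  define \<delta> where "\<delta> = r - 1"
  define C where "C = 1 + (\<Sum>a\<in>Z. cmod (c a))"
  have \<delta>: "\<delta> > 0"
    using assms(3) by (simp add: \<delta>_def)
  have C: "cmod (c a) \<le> C" if "a \<in> Z" for a
    using member_le_sum[of a Z "\<lambda>a. cmod (c a)"] that assms(1) by (simp add: C_def)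
  have C0: "C > 0"
    by (auto simp: C_def intro!: add_pos_nonneg sum_nonneg)
  have far: "\<delta> \<le> cmod (of_real x - a)" if "a \<in> Z" "x \<in> {-1..1}" for a and x :: real
  proof -
    have "cmod a - cmod (of_real x) \<le> cmod (of_real x - a)"
      by (metis norm_minus_commute norm_triangle_ineq2)
    then show ?thesis
      using assms(2)[OF that(1)] that(2) by (auto simp: \<delta>_def abs_le_iff)
  qed
  have far': "\<delta> / 2 \<le> cmod (of_real x - a - of_real \<tau> * c a)"
    if "a \<in> Z" "x \<in> {-1..1}" "0 < \<tau>" "\<tau> < \<delta> / (2 * C)" for a and x \<tau> :: real
  proof -
    have "cmod (of_real \<tau> * c a) \<le> \<tau> * C"
      using C[OF that(1)] that(3) by (simp add: norm_mult)
    also have "\<dots> \<le> \<delta> / 2"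
      using that(4) C0 by (simp add: field_simps)
    finally have "cmod (of_real \<tau> * c a) \<le> \<delta> / 2" .
    moreover have "cmod (of_real x - a) - cmod (of_real \<tau> * c a) \<le> cmod (of_real x - a - of_real \<tau> * c a)"
      by (rule norm_triangle_ineq2)
    ultimately show ?thesis
      using far[OF that(1,2)] by linarith
  qed
  let ?M = "of_nat (card Z) * (2 * C\<^sup>2 / \<delta> ^ 3)"
  show ?thesis
  proof
    show "\<delta> / (2 * C) > 0"
      using \<delta> C0 by simp
  next
    fix \<tau> x :: real assume \<tau>: "0 < \<tau>" "\<tau> < \<delta> / (2 * C)" "x \<in> {-1..1}"
    show "of_real x \<notin># image_mset (\<lambda>a. a + of_real \<tau> * c a) (mset_set Z)"
      using far'[OF _ \<tau>(3,1,2)] \<delta> assms(1) by fastforce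
  next
    fix \<tau> x :: real assume \<tau>: "0 < \<tau>" "\<tau> < \<delta> / (2 * C)" "x \<in> {-1..1}"
    let ?err = "\<lambda>a. 1 / (of_real x - (a + of_real \<tau> * c a)) - 1 / (of_real x - a)
      - of_real \<tau> * (c a / (of_real x - a)\<^sup>2)"
    have "log_deriv (image_mset (\<lambda>a. a + of_real \<tau> * c a) (mset_set Z)) (of_real x)
      = (\<Sum>a\<in>Z. 1 / (of_real x - (a + of_real \<tau> * c a)))"
      by (simp add: log_deriv_def sum_unfold_sum_mset multiset.map_comp o_def)
    then have "log_deriv (image_mset (\<lambda>a. a + of_real \<tau> * c a) (mset_set Z)) (of_real x)
        - log_deriv (mset_set Z) (of_real x) - of_real \<tau> * (\<Sum>a\<in>Z. c a / (of_real x - a)\<^sup>2) = (\<Sum>a\<in>Z. ?err a)"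
      by (simp only: log_deriv_mset_set sum_subtractf sum_distrib_left)
    also have "cmod \<dots> \<le> of_nat (card Z) * (2 * C\<^sup>2 / \<delta> ^ 3 * \<tau>\<^sup>2)"
    proof (rule sum_norm_bound)
      fix a assume a: "a \<in> Z"
      define D where "D = of_real x - a"
      define h where "h = of_real \<tau> * c a"
      have D: "\<delta> \<le> cmod D" and Dh: "\<delta> / 2 \<le> cmod (D - h)"
        using far[OF a \<tau>(3)] far'[OF a \<tau>(3,1,2)] by (simp_all add: D_def h_def)
      then have nz: "D \<noteq> 0" "D - h \<noteq> 0"
        using \<delta> by auto
      have "1 / (D - h) - 1 / D = h / (D * (D - h))"
        using nz by (simp add: divide_simps)
      moreover have "h / (D * (D - h)) - h / D\<^sup>2 = h\<^sup>2 / (D\<^sup>2 * (D - h))"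
        using nz by (simp add: divide_simps power2_eq_square) (simp add: algebra_simps)
      moreover have "?err a = 1 / (D - h) - 1 / D - h / D\<^sup>2"
        by (simp add: D_def h_def diff_diff_eq)
      ultimately have "cmod (?err a) = cmod h ^ 2 / (cmod D ^ 2 * cmod (D - h))"
        by (simp add: norm_divide norm_mult norm_power)
      also have "\<dots> \<le> (\<tau> * C) ^ 2 / (\<delta> ^ 2 * (\<delta> / 2))"
        using D Dh \<delta> C[OF a] \<tau>(1)
        by (intro frac_le mult_mono power_mono mult_pos_pos zero_less_power) (auto simp: h_def norm_mult)
      also have "\<dots> = 2 * C\<^sup>2 / \<delta> ^ 3 * \<tau>\<^sup>2"
        using \<delta> by (simp add: field_simps power2_eq_square power3_eq_cube)
      finally show "cmod (?err a) \<le> 2 * C\<^sup>2 / \<delta> ^ 3 * \<tau>\<^sup>2" .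
    qed
    finally show "cmod (log_deriv (image_mset (\<lambda>a. a + of_real \<tau> * c a) (mset_set Z)) (of_real x)
        - log_deriv (mset_set Z) (of_real x) - of_real \<tau> * (\<Sum>a\<in>Z. c a / (of_real x - a)\<^sup>2)) \<le> ?M * \<tau>\<^sup>2"
      by (simp only: mult.assoc)
  qed
qed

section \<open>Alternance is sufficient\<close>

lemma node_difference_sign:
  fixes t :: "nat \<Rightarrow> real"
  assumes "strict_mono_on {1..N} t" "k \<in> {1..N}"
  shows "(-1) ^ (N - k) * (\<Prod>u\<in>t ` {1..N} - {t k}. t k - u) > 0"
proof -
  have inj: "inj_on t {1..N}"
    using assms(1) by (rule strict_mono_on_imp_inj_on)
  then have "t ` {1..N} - {t k} = t ` ({1..N} - {k})"
    using inj_on_image_set_diff[OF inj, of "{1..N}" "{k}"] assms(2) by simp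
  moreover have "{1..N} - {k} = {1..<k} \<union> {k<..N}"
    using assms(2) by auto
  moreover have inj': "inj_on t ({1..<k} \<union> {k<..N})"
    by (rule inj_on_subset[OF inj]) (use assms(2) in auto)
  ultimately have "(\<Prod>u\<in>t ` {1..N} - {t k}. t k - u) = (\<Prod>j\<in>{1..<k} \<union> {k<..N}. t k - t j)"
    by (simp only: prod.reindex[OF inj'] o_def)
  also have "\<dots> = (\<Prod>j\<in>{1..<k}. t k - t j) * (\<Prod>j\<in>{k<..N}. t k - t j)"
    by (rule prod.union_disjoint) auto
  finally have "(-1) ^ (N - k) * (\<Prod>u\<in>t ` {1..N} - {t k}. t k - u)
      = (\<Prod>j\<in>{1..<k}. t k - t j) * ((\<Prod>j\<in>{k<..N}. -1) * (\<Prod>j\<in>{k<..N}. t k - t j))"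
    by simp
  also have "(\<Prod>j\<in>{k<..N}. -1) * (\<Prod>j\<in>{k<..N}. t k - t j) = (\<Prod>j\<in>{k<..N}. t j - t k)"
    by (simp only: prod.distrib[symmetric]) simp
  also have "(\<Prod>j\<in>{1..<k}. t k - t j) * (\<Prod>j\<in>{k<..N}. t j - t k) > 0"
    using assms by (intro mult_pos_pos prod_pos) (auto simp: strict_mono_on_def)
  finally show ?thesis .
qed

text \<open>With \<open>\<Delta>\<close> the difference of the two logarithmic derivatives and \<open>Q\<close> the monic polynomial of \<open>W\<close>, the alternating relation
becomes \<open>\<Sum>\<^sub>t \<mu> t * Q t * \<Delta> t = 0\<close>, because the factor \<open>P\<close> in the relation cancels the one in \<open>log_deriv_difference\<close>. Here \<open>Q\<close> has
constant sign, whereas \<open>\<mu>\<close> alternates strictly and \<open>\<Delta>\<close> weakly, so every term is zero.\<close>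

lemma alternance_imp_unique:
  assumes "continuous_on {-1..1} f" "finite Z" "cnj ` Z = Z" "\<And>a. a \<in> Z \<Longrightarrow> 1 < cmod a"
    and "card Z = n" "n \<ge> 1"
    and alt: "alternance f (mset_set Z) (n + 1) t"
    and W: "W \<in> admissible n" "deviation f W \<le> deviation f (mset_set Z)"
  shows "W = mset_set Z"
proof -
  let ?Z = "mset_set Z" and ?N = "n + 1"
  have Z_out: "of_real x \<notin> Z" if "x \<in> {-1..1}" for x
    using assms(4)[of "of_real x"] that by (auto simp: abs_le_iff)
  then have "of_real x \<notin># ?Z" if "x \<in> {-1..1}" for x
    using that assms(2) by simp
  from deviation_attained[OF assms(1) this]
  obtain x0 where x0: "deviation f ?Z = ereal \<bar>f x0 - log_deriv_real ?Z x0\<bar>"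
    by blast
  define d where "d = \<bar>f x0 - log_deriv_real ?Z x0\<bar>"
  have dev: "deviation f ?Z = ereal d"
    by (simp add: x0 d_def)
  have real_W: "real_poles W" and size_W: "size W \<le> n"
    using W(1) by (auto simp: admissible_def)
  have W_out: "of_real x \<notin># W" if "x \<in> {-1..1}" for x
    using W(2) that unfolding dev by (auto simp: deviation_def split: if_splits)
  have W_le: "\<bar>f x - log_deriv_real W x\<bar> \<le> d" if "x \<in> {-1..1}" for x
  proof -
    have "ereal \<bar>f x - log_deriv_real W x\<bar> \<le> deviation f W"
      using W_out that unfolding deviation_def by (auto intro: SUP_upper)
    then show ?thesis
      using W(2) unfolding dev by (metis ereal_less_eq(3) order_trans)
  qed
  obtain s where mono: "strict_mono_on {1..?N} t" and T_I: "t ` {1..?N} \<subseteq> {-1..1}"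
    and s: "s \<in> {1, -1::real}"
    and t: "\<And>k. k \<in> {1..?N} \<Longrightarrow> f (t k) - log_deriv_real ?Z (t k) = s * (-1) ^ k * d"
    using alt unfolding alternance_def dev times_ereal.simps(1) ereal.inject by blast
  define T where "T = t ` {1..?N}"
  have T: "finite T" "card T = Suc (card Z)" "T \<subseteq> {-1..1}"
    using T_I strict_mono_on_imp_inj_on[OF mono] assms(5) by (auto simp: T_def card_image)
  define \<Delta> where "\<Delta> = (\<lambda>x. log_deriv_real W x - log_deriv_real ?Z x)"
  have \<Delta>: "log_deriv W (of_real x) - log_deriv ?Z (of_real x) = of_real (\<Delta> x)" for x
    using of_real_log_deriv_real[OF real_W] of_real_log_deriv_real[OF real_poles_mset_set[OF assms(3)]]
    by (simp add: \<Delta>_def)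
  have \<Delta>_sign: "s * (-1) ^ k * \<Delta> (t k) \<ge> 0" if "k \<in> {1..?N}" for k
  proof -
    have I: "t k \<in> {-1..1}"
      by (rule subsetD[OF T_I imageI[OF that]])
    have sq: "(s * (-1) ^ k) * (s * (-1) ^ k) = 1" "\<bar>s * (-1) ^ k\<bar> = 1"
      using s by (auto simp: power_mult_distrib[symmetric] abs_mult)
    \<comment> \<open>The error of \<open>Z\<close> has the extreme value here and that of \<open>W\<close> does not exceed it in modulus.\<close>
    have "\<Delta> (t k) = s * (-1) ^ k * d - (f (t k) - log_deriv_real W (t k))"
      using t[OF that] by (simp add: \<Delta>_def)
    then have "s * (-1) ^ k * \<Delta> (t k)
        = (s * (-1) ^ k) * (s * (-1) ^ k) * d - s * (-1) ^ k * (f (t k) - log_deriv_real W (t k))"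
      by (simp only: right_diff_distrib mult.assoc)
    then have "s * (-1) ^ k * \<Delta> (t k) = d - s * (-1) ^ k * (f (t k) - log_deriv_real W (t k))"
      by (simp only: sq mult_1)
    moreover have "\<bar>s * (-1) ^ k * (f (t k) - log_deriv_real W (t k))\<bar> \<le> d"
      using W_le[OF I] by (simp only: abs_mult[of "s * (-1) ^ k"] sq mult_1)
    ultimately show ?thesis
      by linarith
  qed
  obtain \<sigma> where \<sigma>: "\<sigma> \<in> {1, -1::real}"
    and "\<And>x. x \<in> {-1..1} \<Longrightarrow> \<exists>q>0. poly (monic_poly W) (of_real x) = of_real (\<sigma> * q)"
    using monic_poly_constant_sign[OF real_W W_out] by blast
  then obtain q where q: "\<And>x. x \<in> {-1..1} \<Longrightarrow> q x > 0"
    "\<And>x. x \<in> {-1..1} \<Longrightarrow> poly (monic_poly W) (of_real x) = of_real (\<sigma> * q x)"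
    by metis
  define c where "c = (\<lambda>a. poly (monic_poly W) a / (\<Prod>b\<in>Z - {a}. a - b))"
  have Zne: "Z \<noteq> {}"
    using assms(5,6) by auto
  have u: "(\<Sum>a\<in>Z. c a / (of_real x - a)\<^sup>2) = - of_real (\<sigma> * q x * \<Delta> x) / (\<Prod>a\<in>Z. of_real x - a)"
    if "x \<in> {-1..1}" for x
    using log_deriv_difference[OF assms(2) Zne, of W "of_real x"] Z_out[OF that] W_out[OF that] size_W assms(5)
    unfolding c_def by (simp add: q(2)[OF that] \<Delta>)
  obtain \<mu> where \<mu>: "\<And>t. t \<in> T \<Longrightarrow> \<mu> t * (\<Prod>u\<in>T - {t}. t - u) > 0"
    "\<And>a. a \<in> Z \<Longrightarrow> (\<Sum>t\<in>T. of_real (\<mu> t) * (\<Prod>b\<in>Z. of_real t - b) / (of_real t - a)\<^sup>2) = 0"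
    using double_pole_alternating_relation[OF assms(2-4) T(1,2)] T(3) by auto
  have "0 = (\<Sum>a\<in>Z. c a * (\<Sum>t\<in>T. of_real (\<mu> t) * (\<Prod>b\<in>Z. of_real t - b) / (of_real t - a)\<^sup>2))"
    by (simp add: \<mu>(2))
  also have "\<dots> = (\<Sum>t\<in>T. of_real (\<mu> t) * ((\<Prod>b\<in>Z. of_real t - b) * (\<Sum>a\<in>Z. c a / (of_real t - a)\<^sup>2)))"
    unfolding sum_distrib_left by (subst sum.swap) (simp add: mult_ac)
  also have "\<dots> = (\<Sum>t\<in>T. of_real (\<mu> t) * - of_real (\<sigma> * q t * \<Delta> t))"
  proof (intro sum.cong refl)
    fix t assume "t \<in> T"
    then have I: "t \<in> {-1..1}"
      using T(3) by auto
    then have "(\<Prod>b\<in>Z. of_real t - b) \<noteq> 0"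
      using Z_out assms(2) by auto
    then show "of_real (\<mu> t) * ((\<Prod>b\<in>Z. of_real t - b) * (\<Sum>a\<in>Z. c a / (of_real t - a)\<^sup>2))
        = of_real (\<mu> t) * - of_real (\<sigma> * q t * \<Delta> t)"
      unfolding u[OF I] by simp
  qed
  also have "\<dots> = of_real (- \<sigma> * (\<Sum>t\<in>T. \<mu> t * q t * \<Delta> t))"
    by (simp add: sum_distrib_left sum_negf mult_ac)
  finally have "- \<sigma> * (\<Sum>t\<in>T. \<mu> t * q t * \<Delta> t) = 0"
    by (metis of_real_eq_0_iff)
  then have sum0: "(\<Sum>t\<in>T. s * (-1) ^ ?N * (\<mu> t * q t * \<Delta> t)) = 0"
    unfolding sum_distrib_left[symmetric] using \<sigma> by auto
  have nonneg: "0 \<le> s * (-1) ^ ?N * (\<mu> x * q x * \<Delta> x)" if "x \<in> T" for x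
  proof -
    obtain k where k: "k \<in> {1..?N}" "x = t k"
      using \<open>x \<in> T\<close> unfolding T_def by blast
    have "(-1) ^ (?N - k) * (\<Prod>u\<in>T - {x}. x - u) > 0"
      using node_difference_sign[OF mono k(1)] by (simp only: T_def k(2))
    then have "((-1) ^ (?N - k) * (\<Prod>u\<in>T - {x}. x - u)) * (\<mu> x * (\<Prod>u\<in>T - {x}. x - u)) > 0"
      using \<mu>(1)[OF that] by (rule mult_pos_pos)
    then have "((-1) ^ (?N - k) * \<mu> x) * (\<Prod>u\<in>T - {x}. x - u)\<^sup>2 > 0"
      by (simp only: power2_eq_square mult_ac)
    then have "(-1) ^ (?N - k) * \<mu> x > 0"
      by (rule zero_less_mult_pos2) (use \<mu>(1)[OF that] in auto)
    moreover have "q x > 0"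
      using q(1) that T(3) by auto
    ultimately have "((-1) ^ (?N - k) * \<mu> x) * q x > 0"
      by (rule mult_pos_pos)
    then have "0 \<le> ((-1) ^ (?N - k) * \<mu> x) * q x * (s * (-1) ^ k * \<Delta> x)"
      by (rule mult_nonneg_nonneg[OF less_imp_le \<Delta>_sign[OF k(1), folded k(2)]])
    also have "\<dots> = s * ((-1) ^ (?N - k) * (-1) ^ k) * (\<mu> x * q x * \<Delta> x)"
      by (simp only: mult_ac)
    also have "(-1) ^ (?N - k) * (-1) ^ k = (-1 :: real) ^ ?N"
      using k(1) unfolding power_add[symmetric] by simp
    finally show ?thesis .
  qed
  have "\<forall>x\<in>T. s * (-1) ^ ?N * (\<mu> x * q x * \<Delta> x) = 0"
    by (rule iffD1[OF sum_nonneg_eq_0_iff[OF T(1)] sum0]) (rule nonneg)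
  moreover have "s * (-1) ^ ?N \<noteq> 0"
    using s by auto
  moreover have "\<mu> x \<noteq> 0" "q x \<noteq> 0" if "x \<in> T" for x
    using \<mu>(1)[OF that] q(1)[of x] that T(3) by auto
  ultimately have \<Delta>0: "\<Delta> x = 0" if "x \<in> T" for x
    using that by auto
  \<comment> \<open>Any \<open>n\<close> of the \<open>n + 1\<close> zeros force \<open>c = 0\<close>, and \<open>c a\<close> is a nonzero multiple of \<open>Q a\<close>.\<close>
  obtain T' where T': "T' \<subseteq> T" "card T' = card Z"
    using T(1,2) by (metis obtain_subset_with_card_n le_SucI order_refl)
  have "c a = 0" if "a \<in> Z" for a
  proof (rule double_pole_independent[where c = c and a = a, OF assms(2-4) _ T'(2)])
    show "finite T'" "T' \<subseteq> {-1..1}"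
      using T' T finite_subset by auto
    show "(\<Sum>a\<in>Z. c a / (of_real x - a)\<^sup>2) = 0" if "x \<in> T'" for x
    proof -
      have "x \<in> {-1..1}" "\<Delta> x = 0"
        using that T'(1) T(3) \<Delta>0 by auto
      then show ?thesis
        by (simp only: u) simp
    qed
  qed (use that in simp_all)
  moreover have "(\<Prod>b\<in>Z - {a}. a - b) \<noteq> 0" for a
    using assms(2) by auto
  ultimately have "poly (monic_poly W) a = 0" if "a \<in> Z" for a
    using that by (auto simp: c_def)
  then have "a \<in># W" if "a \<in> Z" for a
    using that poly_monic_poly_eq_0_iff by blast
  then have "?Z \<subseteq># W"
    by (intro mset_subset_eqI) (auto simp: count_mset_set' assms(2) Suc_le_eq)
  then show ?thesis
    using size_W assms(5) mset_subset_size[of ?Z W] by (auto simp: subset_mset_def)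
qed

section \<open>Alternance is necessary\<close>

text \<open>The shift from indices \<open>0..n\<close> to \<open>1..n+1\<close> flips the sign.\<close>

lemma alternating_chain_imp_alternance:
  assumes "strict_mono_on {..n} t" "deviation f Z = ereal d" "s \<in> {1, -1}"
    and "\<And>i. i \<le> n \<Longrightarrow> t i \<in> {-1..1} \<and> f (t i) - log_deriv_real Z (t i) = s * (-1) ^ i * d"
  shows "alternance f Z (n + 1) (\<lambda>k. t (k - 1))"
proof -
  have "f (t (k - 1)) - log_deriv_real Z (t (k - 1)) = - s * (-1) ^ k * d" if "k \<in> {1..n + 1}" for k
    using assms(4)[of "k - 1"] that by (cases k) auto
  then have "\<forall>k\<in>{1..n + 1}. ereal (f (t (k - 1)) - log_deriv_real Z (t (k - 1)))
      = ereal (- s * (-1) ^ k) * deviation f Z"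
    by (simp add: assms(2))
  moreover have "- s \<in> {1, -1}"
    using assms(3) by auto
  moreover have "strict_mono_on {1..n + 1} (\<lambda>k. t (k - 1))"
    by (intro strict_mono_onI strict_mono_onD[OF assms(1)]) auto
  moreover have "(\<lambda>k. t (k - 1)) ` {1..n + 1} \<subseteq> {-1..1}"
    using assms(4) by force
  ultimately show ?thesis
    unfolding alternance_def by blast
qed

text \<open>Let \<open>E s\<close> be the set of points where \<open>f - \<rho> = s * d\<close>, with \<open>d\<close> the deviation. The separating points \<open>Y\<close> are
filled up to \<open>n - 1\<close> points by a set \<open>G\<close> to the right of \<open>1\<close>, but below the moduli of all poles, where \<open>descent_direction\<close> still applies
and no sign change in \<open>[-1,1]\<close> is added.\<close>

lemma best_approx_imp_alternance:
  assumes "continuous_on {-1..1} f" "finite Z" "cnj ` Z = Z" "\<And>a. a \<in> Z \<Longrightarrow> 1 < cmod a"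
    and "card Z = n" "n \<ge> 1"
    and best: "best_approx n f (mset_set Z)"
  shows "\<exists>t. alternance f (mset_set Z) (n + 1) t"
proof (rule ccontr)
  assume no_alt: "\<nexists>t. alternance f (mset_set Z) (n + 1) t"
  let ?Z = "mset_set Z" and ?I = "{-1..1::real}"
  define e where "e = (\<lambda>x. f x - log_deriv_real ?Z x)"
  have Z_out: "of_real x \<notin> Z" if "x \<in> ?I" for x
    using assms(4)[of "of_real x"] that by (auto simp: abs_le_iff)
  then have "of_real x \<notin># ?Z" if "x \<in> ?I" for x
    using that assms(2) by simp
  from deviation_attained[OF assms(1) this]
  obtain x0 where x0: "x0 \<in> ?I" "deviation f ?Z = ereal \<bar>e x0\<bar>" "\<And>y. y \<in> ?I \<Longrightarrow> \<bar>e y\<bar> \<le> \<bar>e x0\<bar>"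
    unfolding e_def by blast
  define d where "d = \<bar>e x0\<bar>"
  have dev: "deviation f ?Z = ereal d" and e_le: "\<And>x. x \<in> ?I \<Longrightarrow> \<bar>e x\<bar> \<le> d"
    using x0 by (auto simp: d_def)
  have e_cont: "continuous_on ?I e"
    unfolding e_def using Z_out assms(1,2) by (intro continuous_intros continuous_on_log_deriv_real) auto
  have d: "d > 0"
  proof (rule ccontr)
    assume "\<not> d > 0"
    \<comment> \<open>If \<open>f\<close> equals the logarithmic derivative, any \<open>n + 1\<close> points form an alternance.\<close>
    then have "e x = 0" if "x \<in> ?I" for x
      using e_le[OF that] by auto
    moreover have "real i / real (n + 1) \<in> ?I" if "i \<le> n" for i
      using that by (auto simp: field_simps)
    moreover have "d = 0"
      using \<open>\<not> d > 0\<close> by (simp add: d_def)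
    ultimately have "alternance f ?Z (n + 1) (\<lambda>k. real (k - 1) / real (n + 1))"
      by (intro alternating_chain_imp_alternance[OF _ dev, of _ _ 1])
         (auto simp: e_def strict_mono_on_def divide_strict_right_mono)
    then show False
      using no_alt by blast
  qed
  define E where "E = (\<lambda>s. {x \<in> ?I. e x = s * d})"
  have E_compact: "compact (E s)" for s
  proof -
    have "closed (?I \<inter> e -` {s * d})"
      by (intro continuous_closed_preimage e_cont) auto
    from compact_Int_closed[OF compact_Icc this] show ?thesis
      by (rule back_subst[of compact]) (auto simp: E_def)
  qed
  have E_disj: "E s \<inter> E (- s) = {}" if "s \<in> {1, -1}" for s
    using that d by (auto simp: E_def)
  have no_chain: "\<nexists>t. strict_mono_on {..n} t \<and> (\<forall>i\<le>n. t i \<in> (if even i then E s else E (- s)))"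
    if "s \<in> {1, -1}" for s
  proof (intro notI, elim exE conjE)
    fix t assume "strict_mono_on {..n} t" and t: "\<forall>i\<le>n. t i \<in> (if even i then E s else E (- s))"
    moreover have "t i \<in> ?I \<and> f (t i) - log_deriv_real ?Z (t i) = s * (-1) ^ i * d" if "i \<le> n" for i
      using t that by (cases "even i") (auto simp: E_def e_def)
    ultimately show False
      using alternating_chain_imp_alternance[OF _ dev that] no_alt by blast
  qed
  have "compact (E 1 \<union> E (-1))"
    by (intro compact_Un E_compact)
  moreover have "E 1 \<union> E (-1) \<noteq> {}"
    using x0(1) by (auto simp: E_def d_def abs_if)
  ultimately have "\<exists>m\<in>E 1 \<union> E (-1). \<forall>x\<in>E 1 \<union> E (-1). m \<le> x"
    by (rule compact_attains_inf)
  then obtain m where m: "m \<in> E 1 \<union> E (-1)" "\<And>x. x \<in> E 1 \<union> E (-1) \<Longrightarrow> m \<le> x"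
    by metis
  then obtain s where s: "s \<in> {1, -1::real}" "m \<in> E s"
    by auto
  have m_le: "m \<le> x" if "x \<in> E s \<union> E (- s)" for x
    using m(2) that s(1) by auto
  have first: "\<exists>a\<in>E s. a < b" if "b \<in> E (- s)" for b
  proof
    have "m \<noteq> b"
      using E_disj[OF s(1)] s(2) that by auto
    then show "m < b"
      using m_le[of b] that by auto
  qed (rule s(2))
  have "E s \<union> E (- s) \<subseteq> ?I"
    by (auto simp: E_def)
  from alternation_or_separation[OF E_compact E_compact E_disj[OF s(1)] this first no_chain[OF s(1)]]
  obtain Y where Y: "finite Y" "card Y \<le> n - 1" "Y \<subseteq> {-1<..<1}"
    "\<And>x. x \<in> E s \<Longrightarrow> (\<Prod>y\<in>Y. y - x) > 0" "\<And>x. x \<in> E (- s) \<Longrightarrow> (\<Prod>y\<in>Y. y - x) < 0"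
    by blast
  obtain r where r: "1 < r" "\<And>a. a \<in> Z \<Longrightarrow> r < cmod a"
  proof
    let ?m = "Min (cmod ` Z)"
    have "Z \<noteq> {}"
      using assms(5,6) by auto
    then have "1 < ?m" "\<And>a. a \<in> Z \<Longrightarrow> ?m \<le> cmod a"
      using assms(2,4) by auto
    then show "1 < (1 + ?m) / 2" "\<And>a. a \<in> Z \<Longrightarrow> (1 + ?m) / 2 < cmod a"
      by force+
  qed
  obtain G where G: "finite G" "card G = n - 1 - card Y" "G \<subseteq> {1<..<r}"
    using infinite_arbitrarily_large[of "{1<..<r}"] r(1) by (auto simp: infinite_Ioo)
  let ?Y = "Y \<union> G"
  have YG: "Y \<inter> G = {}"
    using Y(3) G(3) by force
  then have card_Y: "Suc (card ?Y) = card Z"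
    using Y(1,2) G(1,2) assms(5,6) by (simp add: card_Un_disjoint)
  have Y_sub: "?Y \<subseteq> {-r..r}"
    using Y(3) G(3) r(1) by force
  obtain c where c: "\<And>a. a \<in> Z \<Longrightarrow> c (cnj a) = cnj (c a)"
    "\<And>x. \<lbrakk>x \<in> ?I; x \<notin> ?Y\<rbrakk> \<Longrightarrow> \<exists>p>0. (\<Sum>a\<in>Z. c a / (of_real x - a)\<^sup>2) = of_real (p * (\<Prod>y\<in>?Y. y - x))"
    using descent_direction[OF assms(2,3) r(2) less_imp_le[OF r(1)] finite_UnI[OF Y(1) G(1)] Y_sub card_Y]
    by blast
  define g where "g = (\<lambda>x. Re (\<Sum>a\<in>Z. of_real s * c a / (of_real x - a)\<^sup>2))"
  have e_g: "e x * g x > 0" if x: "x \<in> ?I" "\<bar>e x\<bar> = d" for x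
  proof -
    have G_pos: "(\<Prod>y\<in>G. y - x) > 0"
      using G(3) x(1) by (intro prod_pos) force
    have prod: "(\<Prod>y\<in>?Y. y - x) = (\<Prod>y\<in>Y. y - x) * (\<Prod>y\<in>G. y - x)"
      using Y(1) G(1) YG by (rule prod.union_disjoint)
    have "x \<in> E s \<or> x \<in> E (- s)"
      using x s(1) by (auto simp: E_def abs_if split: if_splits)
    then have sign: "s * e x * (\<Prod>y\<in>?Y. y - x) > 0"
    proof
      assume "x \<in> E s"
      then have "s * e x = d" "(\<Prod>y\<in>Y. y - x) > 0"
        using s(1) Y(4) by (auto simp: E_def)
      then show ?thesis
        unfolding prod using d G_pos by simp
    next
      assume "x \<in> E (- s)"
      then have "s * e x = - d" "(\<Prod>y\<in>Y. y - x) < 0"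
        using s(1) Y(5) by (auto simp: E_def)
      then show ?thesis
        unfolding prod using d G_pos by (simp add: mult_neg_pos mult_pos_neg)
    qed
    have "x \<notin> ?Y"
    proof
      assume "x \<in> ?Y"
      then have "(\<Prod>y\<in>?Y. y - x) = 0"
        using Y(1) G(1) by (intro prod_zero) auto
      then show False
        using sign by simp
    qed
    then obtain p where p: "p > 0" "(\<Sum>a\<in>Z. c a / (of_real x - a)\<^sup>2) = of_real (p * (\<Prod>y\<in>?Y. y - x))"
      using c(2) x(1) by blast
    have "(\<Sum>a\<in>Z. of_real s * c a / (of_real x - a)\<^sup>2) = of_real s * (\<Sum>a\<in>Z. c a / (of_real x - a)\<^sup>2)"
      by (simp add: sum_distrib_left)
    also have "\<dots> = of_real (s * (p * (\<Prod>y\<in>?Y. y - x)))"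
      unfolding p(2) by (simp only: of_real_mult)
    finally have "g x = s * (p * (\<Prod>y\<in>?Y. y - x))"
      unfolding g_def by (simp only: Re_complex_of_real)
    then have "e x * g x = p * (s * e x * (\<Prod>y\<in>?Y. y - x))"
      by (simp add: mult_ac)
    also have "\<dots> > 0"
      using p(1) sign by (rule mult_pos_pos)
    finally show ?thesis .
  qed
  have g_cont: "continuous_on ?I g"
    unfolding g_def using Z_out by (intro continuous_intros) auto
  let ?\<phi> = "\<lambda>\<tau> a. a + of_real \<tau> * (of_real s * c a)"
  let ?P = "\<lambda>\<tau>. image_mset (?\<phi> \<tau>) ?Z"
  obtain \<tau>0 M where \<tau>0: "\<tau>0 > 0"
    and P_out: "\<And>\<tau> x. \<lbrakk>0 < \<tau>; \<tau> < \<tau>0; x \<in> ?I\<rbrakk> \<Longrightarrow> of_real x \<notin># ?P \<tau>"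
    and P_err: "\<And>\<tau> x. \<lbrakk>0 < \<tau>; \<tau> < \<tau>0; x \<in> ?I\<rbrakk> \<Longrightarrow>
      cmod (log_deriv (?P \<tau>) (of_real x) - log_deriv ?Z (of_real x)
        - of_real \<tau> * (\<Sum>a\<in>Z. of_real s * c a / (of_real x - a)\<^sup>2)) \<le> M * \<tau>\<^sup>2"
    using log_deriv_first_order[OF assms(2) r(2,1), of "\<lambda>a. of_real s * c a"] by blast
  have "\<exists>\<tau>>0. \<tau> < \<tau>0 \<and> (\<forall>x\<in>?I. \<bar>e x - (log_deriv_real (?P \<tau>) x - log_deriv_real ?Z x)\<bar> < d)"
  proof (rule first_order_improvement[OF compact_Icc e_cont g_cont e_le e_g \<tau>0, where M = M])
    fix \<tau> x :: real assume \<tau>: "0 < \<tau>" "\<tau> < \<tau>0" "x \<in> ?I"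
    define z where "z = log_deriv (?P \<tau>) (of_real x) - log_deriv ?Z (of_real x)
        - of_real \<tau> * (\<Sum>a\<in>Z. of_real s * c a / (of_real x - a)\<^sup>2)"
    have "Re z = log_deriv_real (?P \<tau>) x - log_deriv_real ?Z x - \<tau> * g x"
      unfolding z_def log_deriv_real_def g_def
      by (simp only: minus_complex.sel Re_complex_of_real times_complex.sel Im_complex_of_real
          mult_zero_left diff_0_right)
    moreover have "cmod z \<le> M * \<tau>\<^sup>2"
      unfolding z_def using P_err[OF \<tau>] .
    ultimately show "\<bar>log_deriv_real (?P \<tau>) x - log_deriv_real ?Z x - \<tau> * g x\<bar> \<le> M * \<tau>\<^sup>2"
      using abs_Re_le_cmod[of z] by linarith
  qed
  then obtain \<tau> where \<tau>: "0 < \<tau>" "\<tau> < \<tau>0" "\<And>x. x \<in> ?I \<Longrightarrow> \<bar>f x - log_deriv_real (?P \<tau>) x\<bar> < d"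
    by (auto simp: e_def)
  obtain x where "x \<in> ?I" "deviation f (?P \<tau>) = ereal \<bar>f x - log_deriv_real (?P \<tau>) x\<bar>"
    using deviation_attained[OF assms(1) P_out[OF \<tau>(1,2)]] by blast
  then have "deviation f (?P \<tau>) < deviation f ?Z"
    using \<tau>(3) dev by simp
  moreover have "?P \<tau> \<in> admissible n"
  proof -
    have "image_mset cnj (?P \<tau>) = image_mset (?\<phi> \<tau>) (image_mset cnj ?Z)"
      unfolding multiset.map_comp using assms(2) c(1) by (intro image_mset_cong) auto
    also have "image_mset cnj ?Z = ?Z"
      using real_poles_mset_set[OF assms(3)] by (simp add: real_poles_def)
    finally show ?thesis
      using assms(5) by (simp add: admissible_def real_poles_def)
  qed
  then have "deviation f ?Z \<le> deviation f (?P \<tau>)"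
    using best unfolding best_approx_def by (metis INF_lower)
  ultimately show False
    by simp
qed

section \<open>The criterion\<close>

theorem theorem3:
  fixes n :: nat and f :: "real \<Rightarrow> real" and Z :: "complex multiset"
  assumes "n \<ge> 1"
    and "continuous_on {-1..1} f"
    and "real_poles Z"
    and "size Z = n"
    and "\<forall>a\<in>#Z. count Z a = 1"
    and "\<forall>a\<in>#Z. cmod a > 1"
  shows "(best_approx n f Z \<and> (\<forall>W. best_approx n f W \<longrightarrow> W = Z)) \<longleftrightarrow>
         (\<exists>t. alternance f Z (n + 1) t)"
proof -
  define S where "S = set_mset Z"
  have Z: "Z = mset_set S"
  proof (rule multiset_eqI)
    fix a
    show "count Z a = count (mset_set S) a"
      using assms(5) by (cases "a \<in># Z") (auto simp: S_def count_mset_set' not_in_iff)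
  qed
  have "size (mset_set S) = n"
    using assms(4) by (simp only: Z[symmetric])
  then have S: "finite S" "card S = n" "\<And>a. a \<in> S \<Longrightarrow> 1 < cmod a"
    using assms(6) by (simp_all add: S_def)
  have S_cnj: "cnj ` S = S"
    using assms(3) unfolding real_poles_def S_def by (metis set_image_mset)
  show ?thesis
  proof
    assume "best_approx n f Z \<and> (\<forall>W. best_approx n f W \<longrightarrow> W = Z)"
    then show "\<exists>t. alternance f Z (n + 1) t"
      using best_approx_imp_alternance[OF assms(2) S(1) S_cnj S(3,2) assms(1), folded Z] by blast
  next
    assume "\<exists>t. alternance f Z (n + 1) t"
    then have unique: "W = Z" if "W \<in> admissible n" "deviation f W \<le> deviation f Z" for W
      using alternance_imp_unique[OF assms(2) S(1) S_cnj S(3,2) assms(1), folded Z] that by blast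
    have Z_adm: "Z \<in> admissible n"
      using assms(3,4) by (simp add: admissible_def)
    moreover have "deviation f Z \<le> deviation f W" if "W \<in> admissible n" for W
      using unique[OF that] linear[of "deviation f W" "deviation f Z"] by auto
    ultimately have inf: "deviation f Z = (INF W\<in>admissible n. deviation f W)"
      by (intro antisym INF_greatest INF_lower)
    then have "best_approx n f Z"
      using Z_adm unfolding best_approx_def by blast
    moreover have "W = Z" if "best_approx n f W" for W
      using that inf unfolding best_approx_def by (intro unique) simp_all
    ultimately show "best_approx n f Z \<and> (\<forall>W. best_approx n f W \<longrightarrow> W = Z)"
      by blast
  qed
qed

end
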